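(* The mixing time of the multi-channel activity process $\{X_C(t)\}_{t\ge0}$ satisfies $$\lim_{\nu\to\infty}\log_\nu t_{\mathrm{mix}}(\varepsilon,\nu)\ \ge\ \Gamma(C)-1,$$ where $\Gamma(C)\ge 1$ is the worst communication height between a pair of dominant states, i.e., $\Gamma(C):=\max_{s,s'\in\mathcal D_C}\Delta(s,s')$.
   Context: Let $V=\{1,\dots,N\}$ be a finite set of nodes and $C\ge1$ the number of channels. For each $c\in\{1,\dots,C\}$ let $G_c=(V,E_c)$ be an undirected graph (the conflict graph on channel $c$; the conflict graphs may differ for different $c$). The set of feasible activity states is $$\mathcal X_C=\{x\in\{0,1,\dots,C\}^N:\ \text{for every } c\in\{1,\dots,C\}\text{ and every }(i,j)\in E_c,\ \text{not both } x_i=c\text{ and }x_j=c\},$$ where $x_i=0$ means that node $i$ is inactive and $x_i=c$ means that node $i$ is active on channel $c$. For a parameter $\nu>1$ (the activation rate), $\{X_C(t)\}_{t\ge0}$ is the continuous-time Markov process on $\mathcal X_C$ with homogeneous transition rates, for $x\neq y$ in $\mathcal X_C$: $q_C(x,y)=\nu$ if $x_i=0$ and $y=x+c\,e_i$ for some $i\in V$, $1\le c\le C$; $q_C(x,y)=1$ if $x_i=c$ and $y=x-c\,e_i$ for some $i\in V$, $1\le c\le C$; $q_C(x,y)=0$ otherwise ($e_i$ is the $i$-th unit vector). For $x\in\mathcal X_C$, let $a(x)=\sum_{i=1}^N\mathbf 1_{\{x_i\ne0\}}$ be the number of active nodes; let $\mathcal A(C)=\max_{x\in\mathcal X_C}a(x)$;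 the set of dominant states is $\mathcal D_C=\{x\in\mathcal X_C:a(x)=\mathcal A(C)\}$. The stationary distribution of the process is $\pi_C(x)=Z^{-1}\nu^{a(x)}$ with $Z=\sum_{x\in\mathcal X_C}\nu^{a(x)}$. A path $\omega:x\to y$ is a finite sequence $\omega_1,\dots,\omega_n\in\mathcal X_C$ with $\omega_1=x$, $\omega_n=y$ and $q_C(\omega_k,\omega_{k+1})>0$ for $k=1,\dots,n-1$. The communication height between $x,y\in\mathcal X_C$ is $$\Delta(x,y)=\min_{\omega:x\to y}\ \max_{z\in\omega}\,(\mathcal A(C)-a(z)).$$ Let $P^t_\nu(x,\cdot)$ be the distribution at time $t$ of the process started at time $0$ in $x$, let $d_t(\nu)=\max_{x\in\mathcal X_C}\|P^t_\nu(x,\cdot)-\pi_C\|_{\mathrm{TV}}$, where $\|\cdot\|_{\mathrm{TV}}$ denotes total variation distance, and define the mixing time by $t_{\mathrm{mix}}(\varepsilon,\nu)=\inf\{t\ge0:d_t(\nu)\le\varepsilon\}$. $\log_\nu$ denotes the logarithm in base $\nu$.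
   Formalization: The limit bound is stated for 0 < ε < 1/2 (it fails for larger ε, e.g. C = 1 with conflict graph K_{3,3}), and Γ(C) ≥ 1 is asserted only when there are at least two dominant states (with one dominant state Γ(C) = 0). *)

theory Defs
  imports "HOL-Analysis.Analysis"
begin

text \<open>
  Throughout, \<open>N\<close> is the number of nodes, \<open>C\<close> the number of channels, and \<open>E c\<close> the edge set of
  the conflict graph on channel \<open>c\<close>, given as a symmetric irreflexive relation on \<open>{1..N}\<close>.
  A state is extensional: outside \<open>{1..N}\<close> it is \<open>undefined\<close>, so that
  there are finitely many states and they are equal iff they agree on the nodes.
\<close>

type_synonym state = "nat \<Rightarrow> nat"

definition simple_graph_on :: "nat set \<Rightarrow> (nat \<times> nat) set \<Rightarrow> bool" where
  "simple_graph_on V R \<longleftrightarrow> R \<subseteq> V \<times> V \<and> sym R \<and> irrefl R"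

definition states :: "nat \<Rightarrow> nat \<Rightarrow> (nat \<Rightarrow> (nat \<times> nat) set) \<Rightarrow> state set" where
  "states N C E =
    {x \<in> {1..N} \<rightarrow>\<^sub>E {0..C}. \<forall>c\<in>{1..C}. \<forall>(i, j)\<in>E c. \<not> (x i = c \<and> x j = c)}"

lemma finite_states: "finite (states N C E)"
proof -
  have "finite ({1..N} \<rightarrow>\<^sub>E {0..C})"
    by (intro finite_PiE) auto
  then show ?thesis
    unfolding states_def by simp
qed


subsection \<open>The activity process\<close>

text \<open>When \<open>x i = 0\<close>, the state \<open>x + c e\<^sub>i\<close> is \<open>x(i := c)\<close>; when \<open>x i = c\<close>, the state
  \<open>x - c e\<^sub>i\<close> is \<open>x(i := 0)\<close>.\<close>

definition rate :: "nat \<Rightarrow> nat \<Rightarrow> real \<Rightarrow> state \<Rightarrow> state \<Rightarrow> real" where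
  "rate N C \<nu> x y =
    (if \<exists>i\<in>{1..N}. \<exists>c\<in>{1..C}. x i = 0 \<and> y = x(i := c) then \<nu>
     else if \<exists>i\<in>{1..N}. \<exists>c\<in>{1..C}. x i = c \<and> y = x(i := 0) then 1
     else 0)"

definition generator ::
    "nat \<Rightarrow> nat \<Rightarrow> (nat \<Rightarrow> (nat \<times> nat) set) \<Rightarrow> real \<Rightarrow> state \<Rightarrow> state \<Rightarrow> real" where
  "generator N C E \<nu> x y =
    (if x = y then - (\<Sum>z\<in>states N C E - {x}. rate N C \<nu> x z) else rate N C \<nu> x y)"

primrec generator_pow ::
    "nat \<Rightarrow> nat \<Rightarrow> (nat \<Rightarrow> (nat \<times> nat) set) \<Rightarrow> real \<Rightarrow> nat \<Rightarrow> state \<Rightarrow> state \<Rightarrow> real" where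
  "generator_pow N C E \<nu> 0 x y = (if x = y then 1 else 0)"
| "generator_pow N C E \<nu> (Suc n) x y =
    (\<Sum>z\<in>states N C E. generator_pow N C E \<nu> n x z * generator N C E \<nu> z y)"

text \<open>The law at time \<open>t\<close> of the continuous-time Markov process with the above rates started in
  \<open>x\<close>: the row \<open>x\<close> of the matrix exponential \<open>exp (t Q)\<close> of the generator \<open>Q\<close>.
  The lemmas \<open>transition_0\<close> and \<open>transition_forward\<close> confirm that it solves the
  Kolmogorov forward equation with initial law the point mass at \<open>x\<close>.\<close>

definition transition ::
    "nat \<Rightarrow> nat \<Rightarrow> (nat \<Rightarrow> (nat \<times> nat) set) \<Rightarrow> real \<Rightarrow> real \<Rightarrow> state \<Rightarrow> state \<Rightarrow> real" where
  "transition N C E \<nu> t x y = (\<Sum>n. t ^ n / fact n * generator_pow N C E \<nu> n x y)"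

lemma transition_0: "transition N C E \<nu> 0 x y = (if x = y then 1 else 0)"
proof -
  have "transition N C E \<nu> 0 x y =
      (\<Sum>n. (generator_pow N C E \<nu> n x y / fact n) * 0 ^ n)"
    unfolding transition_def by (simp add: mult.commute)
  also have "\<dots> = generator_pow N C E \<nu> 0 x y / fact 0"
    by (rule powser_zero)
  finally show ?thesis by simp
qed

lemma generator_pow_bound:
  fixes N C E \<nu>
  defines "K \<equiv> (\<Sum>y\<in>states N C E. \<Sum>z\<in>states N C E. \<bar>generator N C E \<nu> z y\<bar>)"
  assumes "y \<in> states N C E"
  shows "\<bar>generator_pow N C E \<nu> n x y\<bar> \<le> K ^ n"
  using assms(2)
proof (induction n arbitrary: y)
  case 0
  then show ?case by simp
next
  case (Suc n)
  have K0: "K \<ge> 0"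
    unfolding K_def by (intro sum_nonneg) simp
  have "\<bar>generator_pow N C E \<nu> (Suc n) x y\<bar>
      \<le> (\<Sum>z\<in>states N C E. \<bar>generator_pow N C E \<nu> n x z\<bar> * \<bar>generator N C E \<nu> z y\<bar>)"
    unfolding generator_pow.simps abs_mult[symmetric] by (rule sum_abs)
  also have "\<dots> \<le> (\<Sum>z\<in>states N C E. K ^ n * \<bar>generator N C E \<nu> z y\<bar>)"
    by (intro sum_mono mult_right_mono Suc.IH) auto
  also have "\<dots> = K ^ n * (\<Sum>z\<in>states N C E. \<bar>generator N C E \<nu> z y\<bar>)"
    by (simp add: sum_distrib_left)
  also have "\<dots> \<le> K ^ n * K"
    unfolding K_def using Suc.prems
    by (intro mult_left_mono
        member_le_sum[where f = "\<lambda>y. \<Sum>z\<in>states N C E. \<bar>generator N C E \<nu> z y\<bar>"]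
        zero_le_power sum_nonneg)
      (auto intro: sum_nonneg finite_states)
  finally show ?case by (simp add: mult.commute)
qed

lemma summable_transition:
  assumes "y \<in> states N C E"
  shows "summable (\<lambda>n. generator_pow N C E \<nu> n x y / fact n * t ^ n)"
proof -
  define K where "K = (\<Sum>y\<in>states N C E. \<Sum>z\<in>states N C E. \<bar>generator N C E \<nu> z y\<bar>)"
  have "summable (\<lambda>n. (K * \<bar>t\<bar>) ^ n / fact n)"
    using summable_exp[of "K * \<bar>t\<bar>"] by (simp add: divide_inverse mult.commute)
  moreover have "norm (generator_pow N C E \<nu> n x y / fact n * t ^ n) \<le> (K * \<bar>t\<bar>) ^ n / fact n" for n
    using generator_pow_bound[OF assms, of \<nu> n x]
    by (auto simp: K_def abs_mult power_mult_distrib power_abs intro!: divide_right_mono mult_right_mono)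
  ultimately show ?thesis
    by (rule summable_comparison_test'[where N = 0])
qed

lemma transition_forward:
  assumes y: "y \<in> states N C E"
  shows "((\<lambda>t. transition N C E \<nu> t x y) has_real_derivative
          (\<Sum>z\<in>states N C E. transition N C E \<nu> t x z * generator N C E \<nu> z y)) (at t)"
proof -
  define g where "g z n = generator_pow N C E \<nu> n x z / fact n" for z n
  have tr: "transition N C E \<nu> t x z = (\<Sum>n. g z n * t ^ n)" for t z
    unfolding transition_def g_def by (simp add: mult.commute)
  have sm: "summable (\<lambda>n. g z n * t ^ n)" if "z \<in> states N C E" for z t
    unfolding g_def using summable_transition[OF that] .
  have "(\<Sum>n. diffs (g y) n * t ^ n)
      = (\<Sum>n. \<Sum>z\<in>states N C E. g z n * t ^ n * generator N C E \<nu> z y)"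
  proof (rule suminf_cong)
    fix n
    have "diffs (g y) n = generator_pow N C E \<nu> (Suc n) x y / fact n"
      unfolding diffs_def g_def by (simp add: fact_Suc del: of_nat_Suc generator_pow.simps)
    also have "\<dots> = (\<Sum>z\<in>states N C E. g z n * generator N C E \<nu> z y)"
      unfolding g_def by (simp add: sum_divide_distrib)
    finally show "diffs (g y) n * t ^ n
        = (\<Sum>z\<in>states N C E. g z n * t ^ n * generator N C E \<nu> z y)"
      by (simp add: sum_distrib_left mult_ac)
  qed
  also have "\<dots> = (\<Sum>z\<in>states N C E. \<Sum>n. g z n * t ^ n * generator N C E \<nu> z y)"
    by (rule suminf_sum) (intro summable_mult2 sm)
  also have "\<dots> = (\<Sum>z\<in>states N C E. transition N C E \<nu> t x z * generator N C E \<nu> z y)"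
    by (intro sum.cong refl) (simp add: tr suminf_mult2[OF sm])
  finally show ?thesis
    using termdiffs_strong_converges_everywhere[of "g y" t] sm[OF y] by (simp add: tr)
qed


subsection \<open>Dominant states and communication height\<close>

definition active :: "nat \<Rightarrow> state \<Rightarrow> nat" where
  "active N x = card {i \<in> {1..N}. x i \<noteq> 0}"

definition max_active :: "nat \<Rightarrow> nat \<Rightarrow> (nat \<Rightarrow> (nat \<times> nat) set) \<Rightarrow> nat" where
  "max_active N C E = Max (active N ` states N C E)"

definition dominant :: "nat \<Rightarrow> nat \<Rightarrow> (nat \<Rightarrow> (nat \<times> nat) set) \<Rightarrow> state set" where
  "dominant N C E = {x \<in> states N C E. active N x = max_active N C E}"

text \<open>Which rates are positive does not depend on \<open>\<nu> > 1\<close>, hence neither does the set of paths.\<close>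

definition is_path ::
    "nat \<Rightarrow> nat \<Rightarrow> (nat \<Rightarrow> (nat \<times> nat) set) \<Rightarrow> state \<Rightarrow> state list \<Rightarrow> state \<Rightarrow> bool" where
  "is_path N C E x \<omega> y \<longleftrightarrow>
    \<omega> \<noteq> [] \<and> set \<omega> \<subseteq> states N C E \<and> hd \<omega> = x \<and> last \<omega> = y \<and>
    (\<forall>k. Suc k < length \<omega> \<longrightarrow> (\<forall>\<nu>>1. rate N C \<nu> (\<omega> ! k) (\<omega> ! Suc k) > 0))"

text \<open>The subtraction on \<open>nat\<close> does not truncate, since paths consist of feasible states.\<close>

definition path_height ::
    "nat \<Rightarrow> nat \<Rightarrow> (nat \<Rightarrow> (nat \<times> nat) set) \<Rightarrow> state list \<Rightarrow> nat" where
  "path_height N C E \<omega> = Max ((\<lambda>z. max_active N C E - active N z) ` set \<omega>)"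

definition comm_height ::
    "nat \<Rightarrow> nat \<Rightarrow> (nat \<Rightarrow> (nat \<times> nat) set) \<Rightarrow> state \<Rightarrow> state \<Rightarrow> nat" where
  "comm_height N C E x y = Min {path_height N C E \<omega> |\<omega>. is_path N C E x \<omega> y}"

definition worst_height :: "nat \<Rightarrow> nat \<Rightarrow> (nat \<Rightarrow> (nat \<times> nat) set) \<Rightarrow> nat" where
  "worst_height N C E =
    Max {comm_height N C E s s' |s s'. s \<in> dominant N C E \<and> s' \<in> dominant N C E}"


subsection \<open>Mixing time\<close>

definition stationary ::
    "nat \<Rightarrow> nat \<Rightarrow> (nat \<Rightarrow> (nat \<times> nat) set) \<Rightarrow> real \<Rightarrow> state \<Rightarrow> real" where
  "stationary N C E \<nu> x = \<nu> ^ active N x / (\<Sum>y\<in>states N C E. \<nu> ^ active N y)"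

definition tv_dist :: "'a set \<Rightarrow> ('a \<Rightarrow> real) \<Rightarrow> ('a \<Rightarrow> real) \<Rightarrow> real" where
  "tv_dist S p q = Max ((\<lambda>A. \<bar>sum p A - sum q A\<bar>) ` Pow S)"

definition mix_dist ::
    "nat \<Rightarrow> nat \<Rightarrow> (nat \<Rightarrow> (nat \<times> nat) set) \<Rightarrow> real \<Rightarrow> real \<Rightarrow> real" where
  "mix_dist N C E \<nu> t =
    Max ((\<lambda>x. tv_dist (states N C E) (transition N C E \<nu> t x) (stationary N C E \<nu>)) ` states N C E)"

definition t_mix ::
    "nat \<Rightarrow> nat \<Rightarrow> (nat \<Rightarrow> (nat \<times> nat) set) \<Rightarrow> real \<Rightarrow> real \<Rightarrow> real" where
  "t_mix N C E \<epsilon> \<nu> = Inf {t. 0 \<le> t \<and> mix_dist N C E \<nu> t \<le> \<epsilon>}"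

end

theory Submission
  imports Defs
begin

text \<open>
  The process is reversible, with conductance \<open>\<nu> ^ max (a x) (a y) / Z\<close> on the link between \<open>x\<close> and \<open>y\<close>.
  Call \<open>x\<close> and \<open>y\<close> separated at level \<open>k\<close> if every path between them uses a link with
  \<open>max (a u) (a v) \<le> k\<close>, and let \<open>M\<close> be the maximum of \<open>a x + a y - k\<close> over all such triples.
  The mixing time has order \<open>\<nu> powr (M - A)\<close> up to a factor logarithmic in \<open>\<nu>\<close>, where \<open>A\<close> is the maximal activity,
  so the limit exists and equals \<open>M - A\<close>. The lower bound is the bottleneck estimate for the cut
  around a maximizing triple. The upper bound follows from the Poincare inequality obtained by joining
  each pair along a path through links above its separation level. Two dominant states with communication height
  \<open>\<Gamma> > 0\<close> are separated at level \<open>A - \<Gamma> + 1\<close>, whence \<open>M - A \<ge> \<Gamma> - 1\<close>; if \<open>\<Gamma> = 0\<close>, a dominant state and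
  a neighbour with one node fewer, separated at level \<open>A\<close>, give \<open>M - A \<ge> -1\<close>.
\<close>

subsection \<open>Mixing of reversible chains\<close>

text \<open>Squaring removes the kink of \<open>min\<close> at 0, so the energy of the negative part
  of a heat solution can be differentiated.\<close>

lemma DERIV_min_0_power2:
  "((\<lambda>u::real. (min u 0)\<^sup>2) has_real_derivative 2 * min u 0) (at u)"
proof -
  consider "u < 0" | "u = 0" | "u > 0" by linarith
  then show ?thesis
  proof cases
    case 1
    have "((\<lambda>u::real. u\<^sup>2) has_real_derivative 2 * u) (at u)"
      by (auto intro!: derivative_eq_intros)
    moreover have "eventually (\<lambda>v. v\<^sup>2 = (min v 0)\<^sup>2) (nhds u)"
      using eventually_nhds_in_open[of "{..<0}" u] 1 by (auto elim!: eventually_mono)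
    ultimately have "((\<lambda>u::real. (min u 0)\<^sup>2) has_real_derivative 2 * u) (at u)"
      by (subst (asm) DERIV_cong_ev[OF refl _ refl])
    then show ?thesis using 1 by simp
  next
    case 2
    \<comment> \<open>At the kink the difference quotient is bounded by the absolute value of
      \<open>h\<close>.\<close>
    have "((\<lambda>h::real. (min h 0)\<^sup>2 / h) \<longlongrightarrow> 0) (at 0)"
    proof (rule Lim_null_comparison)
      show "\<forall>\<^sub>F h in at 0. norm ((min h 0)\<^sup>2 / h) \<le> \<bar>h :: real\<bar>"
        by (intro always_eventually) (auto simp: min_def power2_eq_square)
      show "((\<lambda>h::real. \<bar>h\<bar>) \<longlongrightarrow> 0) (at 0)" by (auto intro!: tendsto_eq_intros)
    qed
    then show ?thesis using 2 by (simp add: DERIV_def)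
  next
    case 3
    have "((\<lambda>u::real. 0) has_real_derivative 0) (at u)" by simp
    moreover have "eventually (\<lambda>v. 0 = (min v 0)\<^sup>2) (nhds u)"
      using eventually_nhds_in_open[of "{0<..}" u] 3 by (auto elim!: eventually_mono)
    ultimately have "((\<lambda>u::real. (min u 0)\<^sup>2) has_real_derivative 0) (at u)"
      by (subst (asm) DERIV_cong_ev[OF refl _ refl])
    then show ?thesis using 3 by simp
  qed
qed

section \<open>Dirichlet form, heat equation and maximum principle\<close>

locale reversible_chain =
  fixes S :: "'a set" and \<pi> :: "'a \<Rightarrow> real" and Q :: "'a \<Rightarrow> 'a \<Rightarrow> real"
    and P :: "real \<Rightarrow> 'a \<Rightarrow> 'a \<Rightarrow> real"
  assumes finite_S: "finite S"
    and pi_pos: "x \<in> S \<Longrightarrow> 0 < \<pi> x"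
    and sum_pi: "sum \<pi> S = 1"
    and Q_nonneg: "x \<in> S \<Longrightarrow> y \<in> S \<Longrightarrow> x \<noteq> y \<Longrightarrow> 0 \<le> Q x y"
    and detailed_balance: "x \<in> S \<Longrightarrow> y \<in> S \<Longrightarrow> \<pi> x * Q x y = \<pi> y * Q y x"
    and row_sum: "x \<in> S \<Longrightarrow> (\<Sum>y\<in>S. Q x y) = 0"
    and P_0: "P 0 x y = (if x = y then 1 else 0)"
    and P_forward: "x \<in> S \<Longrightarrow> y \<in> S \<Longrightarrow>
      ((\<lambda>t. P t x y) has_real_derivative (\<Sum>z\<in>S. P t x z * Q z y)) (at t)"
begin

text \<open>Ordered pairs are summed and halved, so each link counts once. The diagonal entries of
  \<open>Q\<close> only meet zero differences.\<close>

definition dirichlet :: "('a \<Rightarrow> real) \<Rightarrow> ('a \<Rightarrow> real) \<Rightarrow> real" where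
  "dirichlet f g = (\<Sum>x\<in>S. \<Sum>y\<in>S. \<pi> x * Q x y * ((f x - f y) * (g x - g y))) / 2"

text \<open>The backward equation, acting on functions: densities with respect to \<pi> solve it,
  while the laws themselves solve the forward equation.\<close>

definition heat_solution :: "(real \<Rightarrow> 'a \<Rightarrow> real) \<Rightarrow> bool" where
  "heat_solution h \<longleftrightarrow>
    (\<forall>t. \<forall>y\<in>S. ((\<lambda>t. h t y) has_real_derivative (\<Sum>z\<in>S. Q y z * h t z)) (at t))"

lemma heat_solutionD:
  "heat_solution h \<Longrightarrow> y \<in> S \<Longrightarrow>
    ((\<lambda>t. h t y) has_real_derivative (\<Sum>z\<in>S. Q y z * h t z)) (at t)"
  unfolding heat_solution_def by blast

text \<open>Expanding the product of differences gives two sums of diagonal type, which vanish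
  because the rows of \<open>Q\<close> sum to zero, and two mixed sums, which agree by detailed
  balance.\<close>

lemma green:
  "(\<Sum>x\<in>S. \<pi> x * f x * (\<Sum>y\<in>S. Q x y * g y)) = - dirichlet f g"
proof -
  let ?c = "\<lambda>x y. \<pi> x * Q x y"
  have diag: "(\<Sum>x\<in>S. \<Sum>y\<in>S. ?c x y * (f x * g x)) = 0"
  proof (rule sum.neutral, rule ballI)
    fix x assume "x \<in> S"
    have "(\<Sum>y\<in>S. ?c x y * (f x * g x)) = \<pi> x * f x * g x * (\<Sum>y\<in>S. Q x y)"
      by (simp add: sum_distrib_left mult_ac)
    then show "(\<Sum>y\<in>S. ?c x y * (f x * g x)) = 0"
      using row_sum[OF \<open>x \<in> S\<close>] by simp
  qed
  \<comment> \<open>The conductance \<open>\<pi> x * Q x y\<close> is symmetric, so the summation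
    indices may be exchanged.\<close>
  have sw: "(\<Sum>x\<in>S. \<Sum>y\<in>S. ?c x y * k y x) = (\<Sum>x\<in>S. \<Sum>y\<in>S. ?c x y * k x y)" for k :: "'a \<Rightarrow> 'a \<Rightarrow> real"
    by (subst sum.swap) (intro sum.cong refl, simp add: detailed_balance)
  have diag': "(\<Sum>x\<in>S. \<Sum>y\<in>S. ?c x y * (f y * g y)) = 0"
    using sw[of "\<lambda>x y. f x * g x"] diag by simp
  have cross: "(\<Sum>x\<in>S. \<Sum>y\<in>S. ?c x y * (f y * g x)) = (\<Sum>x\<in>S. \<Sum>y\<in>S. ?c x y * (f x * g y))"
    using sw[of "\<lambda>x y. f x * g y"] .
  have "2 * dirichlet f g = (\<Sum>x\<in>S. \<Sum>y\<in>S. ?c x y * (f x * g x)) + (\<Sum>x\<in>S. \<Sum>y\<in>S. ?c x y * (f y * g y))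
      - (\<Sum>x\<in>S. \<Sum>y\<in>S. ?c x y * (f y * g x)) - (\<Sum>x\<in>S. \<Sum>y\<in>S. ?c x y * (f x * g y))"
    unfolding dirichlet_def sum.distrib[symmetric] sum_subtractf[symmetric]
    by (simp add: algebra_simps)
  also have "\<dots> = - 2 * (\<Sum>x\<in>S. \<Sum>y\<in>S. ?c x y * (f x * g y))"
    using diag diag' cross by simp
  also have "(\<Sum>x\<in>S. \<Sum>y\<in>S. ?c x y * (f x * g y)) = (\<Sum>x\<in>S. \<pi> x * f x * (\<Sum>y\<in>S. Q x y * g y))"
    by (simp add: sum_distrib_left mult_ac)
  finally show ?thesis by simp
qed

text \<open>Two functions varying in the same direction are allowed because
  \<open>heat_nonneg\<close> pairs a solution with its truncation at 0.\<close>

lemma dirichlet_nonneg: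
  assumes "\<And>x y. x \<in> S \<Longrightarrow> y \<in> S \<Longrightarrow> 0 \<le> (f x - f y) * (g x - g y)"
  shows "0 \<le> dirichlet f g"
proof -
  have "0 \<le> \<pi> x * Q x y * ((f x - f y) * (g x - g y))" if "x \<in> S" "y \<in> S" for x y
    using assms[OF that] pi_pos[of x] Q_nonneg[of x y] that by (cases "x = y") auto
  then show ?thesis unfolding dirichlet_def by (intro divide_nonneg_pos sum_nonneg) auto
qed

text \<open>A constant \<open>f\<close> yields conservation of the mean; an indicator yields the
  flow across a cut.\<close>

lemma heat_mean_deriv:
  assumes "heat_solution h"
  shows "((\<lambda>t. \<Sum>y\<in>S. \<pi> y * f y * h t y) has_real_derivative - dirichlet f (h t)) (at t)"
  unfolding green[symmetric]
  by (intro DERIV_sum DERIV_cmult heat_solutionD[OF assms])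

lemma heat_solution_diff:
  assumes "heat_solution g" "heat_solution h"
  shows "heat_solution (\<lambda>t y. g t y - h t y)"
  using assms unfolding heat_solution_def
  by (auto simp: right_diff_distrib sum_subtractf intro!: DERIV_diff)

lemma heat_solution_const: "heat_solution (\<lambda>t y. a)"
  unfolding heat_solution_def by (simp add: sum_distrib_right[symmetric] row_sum)

text \<open>Detailed balance turns the forward equation for the law started from the weights
  \<open>A\<close> into the backward equation for its density.\<close>

lemma heat_solution_density: "heat_solution (\<lambda>t y. (\<Sum>x\<in>S. A x * P t x y) / \<pi> y)"
  unfolding heat_solution_def
proof (intro allI ballI)
  fix t y assume y: "y \<in> S"
  have "(\<Sum>x\<in>S. A x * (\<Sum>z\<in>S. P t x z * Q z y)) = (\<Sum>z\<in>S. (\<Sum>x\<in>S. A x * P t x z) * Q z y)"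
    by (simp add: sum_distrib_left sum_distrib_right mult_ac) (rule sum.swap)
  also have "\<dots> = (\<Sum>z\<in>S. \<pi> y * (Q y z * ((\<Sum>x\<in>S. A x * P t x z) / \<pi> z)))"
  proof (rule sum.cong[OF refl])
    fix z assume z: "z \<in> S"
    have "Q z y = \<pi> y * Q y z / \<pi> z"
      using detailed_balance[OF y z] pi_pos[OF z] by (simp add: field_simps)
    then show "(\<Sum>x\<in>S. A x * P t x z) * Q z y = \<pi> y * (Q y z * ((\<Sum>x\<in>S. A x * P t x z) / \<pi> z))"
      by simp
  qed
  finally have eq: "(\<Sum>x\<in>S. A x * (\<Sum>z\<in>S. P t x z * Q z y)) / \<pi> y
      = (\<Sum>z\<in>S. Q y z * ((\<Sum>x\<in>S. A x * P t x z) / \<pi> z))"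
    using pi_pos[OF y] by (simp only: sum_distrib_left[symmetric]) simp
  show "((\<lambda>t. (\<Sum>x\<in>S. A x * P t x y) / \<pi> y) has_real_derivative
      (\<Sum>z\<in>S. Q y z * ((\<Sum>x\<in>S. A x * P t x z) / \<pi> z))) (at t)"
    unfolding eq[symmetric]
    by (intro DERIV_cdivide DERIV_sum DERIV_cmult P_forward y)
qed

text \<open>Maximum principle: \<open>min (h t y) 0\<close> is monotone in \<open>h t y\<close>, so
  the Dirichlet form of the two is nonnegative and the energy of the negative part cannot grow from
  its initial value 0.\<close>

lemma heat_nonneg:
  assumes h: "heat_solution h" and init: "\<And>y. y \<in> S \<Longrightarrow> 0 \<le> h 0 y" and "0 \<le> t" "y \<in> S"
  shows "0 \<le> h t y"
proof -
  define F where "F t = (\<Sum>y\<in>S. \<pi> y * (min (h t y) 0)\<^sup>2)" for t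
  have "(F has_real_derivative
      (\<Sum>y\<in>S. \<pi> y * (2 * min (h t y) 0 * (\<Sum>z\<in>S. Q y z * h t z)))) (at t)" for t
    unfolding F_def
    by (intro DERIV_sum DERIV_cmult DERIV_chain2[OF DERIV_min_0_power2] heat_solutionD[OF h])
  moreover have "(\<Sum>y\<in>S. \<pi> y * (2 * min (h t y) 0 * (\<Sum>z\<in>S. Q y z * h t z))) \<le> 0" for t
  proof -
    have "0 \<le> dirichlet (\<lambda>y. min (h t y) 0) (h t)"
      by (rule dirichlet_nonneg) (auto simp: min_def mult_nonpos_nonpos mult_nonneg_nonneg zero_le_mult_iff)
    moreover have "(\<Sum>y\<in>S. \<pi> y * (2 * min (h t y) 0 * (\<Sum>z\<in>S. Q y z * h t z)))
        = 2 * - dirichlet (\<lambda>y. min (h t y) 0) (h t)"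
      unfolding green[symmetric] by (simp only: sum_distrib_left mult_ac)
    ultimately show ?thesis by simp
  qed
  ultimately have "F t \<le> F 0"
    using \<open>0 \<le> t\<close> by (intro DERIV_nonpos_imp_nonincreasing[of 0 t F]) blast+
  also have "F 0 = 0" unfolding F_def using init by (intro sum.neutral ballI) (simp add: min_absorb2)
  finally have "F t \<le> 0" .
  moreover have nn: "0 \<le> \<pi> y * (min (h t y) 0)\<^sup>2" if "y \<in> S" for y
    using pi_pos[OF that] by simp
  moreover have "0 \<le> F t" unfolding F_def by (rule sum_nonneg[OF nn])
  ultimately have "F t = 0" by simp
  then have "\<pi> y * (min (h t y) 0)\<^sup>2 = 0"
    unfolding F_def using nn \<open>y \<in> S\<close> finite_S by (subst (asm) sum_nonneg_eq_0_iff) auto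
  then show ?thesis using pi_pos[OF \<open>y \<in> S\<close>] by (auto simp: min_def split: if_splits)
qed

section \<open>Escape from a set and the lower bound on mixing\<close>

lemma escape_bound:
  assumes A: "A \<subseteq> S" and t: "0 \<le> t"
    and flow: "\<And>x y. x \<in> A \<Longrightarrow> y \<in> S - A \<Longrightarrow> \<pi> x * Q x y \<le> b" and "0 \<le> b"
  shows "(\<Sum>x\<in>A. \<pi> x * sum (P t x) (S - A)) \<le> t * (b * (real (card S))\<^sup>2)"
proof -
  \<comment> \<open>The density at time \<open>t\<close> of the chain started from \<pi> restricted
    to \<open>A\<close>. It begins as the indicator of \<open>A\<close>, and the maximum principle
    for \<open>h\<close> and \<open>1 - h\<close> keeps it between 0 and 1.\<close>
  define h where "h t y = (\<Sum>x\<in>S. (\<pi> x * indicator A x) * P t x y) / \<pi> y" for t y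
  have hs: "heat_solution h" unfolding h_def by (rule heat_solution_density)
  have h0: "h 0 y = indicator A y" if "y \<in> S" for y
    using pi_pos[OF that] that finite_S unfolding h_def P_0
    by (simp add: if_distrib cong: if_cong)
  have lo: "0 \<le> h t y" if "0 \<le> t" "y \<in> S" for t y
    by (rule heat_nonneg[OF hs _ that]) (simp add: h0)
  have hi: "h t y \<le> 1" if "0 \<le> t" "y \<in> S" for t y
    using heat_nonneg[OF heat_solution_diff[OF heat_solution_const[of 1] hs] _ that]
    by (simp add: h0 indicator_def)
  define f :: "'a \<Rightarrow> real" where "f y = indicator (S - A) y" for y
  define G where "G t = (\<Sum>y\<in>S. \<pi> y * f y * h t y)" for t
  have dG: "(G has_real_derivative - dirichlet f (h t)) (at t)" for t
    unfolding G_def by (rule heat_mean_deriv[OF hs])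
  \<comment> \<open>\<open>G\<close> is the mass outside \<open>A\<close>, and this bounds its
    growth rate. Only pairs across the cut contribute, each at most \<open>b\<close>; all ordered
    pairs are counted and the factor one half is dropped.\<close>
  have bound: "- dirichlet f (h t) \<le> b * (real (card S))\<^sup>2" if "0 \<le> t" for t
  proof -
    have "- (\<pi> x * Q x y * ((f x - f y) * (h t x - h t y))) \<le> b" if xy: "x \<in> S" "y \<in> S" for x y
    proof -
      have d: "\<bar>h t x - h t y\<bar> \<le> 1"
        using lo[OF \<open>0 \<le> t\<close>, of x] hi[OF \<open>0 \<le> t\<close>, of x] lo[OF \<open>0 \<le> t\<close>, of y] hi[OF \<open>0 \<le> t\<close>, of y] xy by auto
      show ?thesis
      proof (cases "(x \<in> A) = (y \<in> A)")
        case True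
        then have "f x = f y" using xy by (auto simp: f_def indicator_def)
        then show ?thesis using \<open>0 \<le> b\<close> by simp
      next
        case False
        then have nn: "0 \<le> \<pi> x * Q x y" using xy pi_pos[of x] Q_nonneg[of x y] by fastforce
        have ub: "\<pi> x * Q x y \<le> b"
          using False flow[of x y] flow[of y x] detailed_balance[OF xy] xy by auto
        have one: "\<bar>f x - f y\<bar> = 1" using False xy by (auto simp: f_def indicator_def)
        have "- (\<pi> x * Q x y * ((f x - f y) * (h t x - h t y)))
            \<le> \<bar>\<pi> x * Q x y * ((f x - f y) * (h t x - h t y))\<bar>" by linarith
        also have "\<dots> = \<pi> x * Q x y * \<bar>h t x - h t y\<bar>" 
          using nn one abs_of_nonneg[OF nn] by (simp only: abs_mult mult_1_left)
        also have "\<dots> \<le> \<pi> x * Q x y * 1" using nn d by (intro mult_left_mono) auto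
        finally show ?thesis using ub by simp
      qed
    qed
    then have "(\<Sum>x\<in>S. \<Sum>y\<in>S. - (\<pi> x * Q x y * ((f x - f y) * (h t x - h t y)))) \<le> (\<Sum>x\<in>S. \<Sum>y\<in>S. b)"
      by (intro sum_mono)
    moreover have "0 \<le> b * (real (card S))\<^sup>2" using \<open>0 \<le> b\<close> by simp
    ultimately show ?thesis
      unfolding dirichlet_def by (simp add: sum_negf power2_eq_square mult_ac)
  qed
  have "G t - b * (real (card S))\<^sup>2 * t \<le> G 0 - b * (real (card S))\<^sup>2 * 0"
  proof (rule DERIV_nonpos_imp_nonincreasing[OF t])
    fix s :: real assume "0 \<le> s"
    then show "\<exists>D. ((\<lambda>t. G t - b * (real (card S))\<^sup>2 * t) has_real_derivative D) (at s) \<and> D \<le> 0"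
      using bound[of s]
      by (intro exI[of _ "- dirichlet f (h s) - b * (real (card S))\<^sup>2 * 1"] conjI DERIV_diff dG DERIV_cmult DERIV_ident) auto
  qed
  moreover have "G 0 = 0" unfolding G_def by (auto simp: h0 f_def indicator_def intro!: sum.neutral)
  moreover have "G t = (\<Sum>x\<in>A. \<pi> x * sum (P t x) (S - A))"
  proof -
    have "G t = (\<Sum>y\<in>S - A. \<pi> y * h t y)"
      unfolding G_def f_def using finite_S
      by (intro sum.mono_neutral_cong_right) (auto simp: indicator_def)
    also have "\<dots> = (\<Sum>y\<in>S - A. \<Sum>x\<in>A. \<pi> x * P t x y)"
    proof (rule sum.cong[OF refl])
      fix y assume y: "y \<in> S - A"
      have "\<pi> y * h t y = (\<Sum>x\<in>S. (\<pi> x * indicator A x) * P t x y)"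
        unfolding h_def using pi_pos[of y] y by simp
      also have "\<dots> = (\<Sum>x\<in>A. \<pi> x * P t x y)"
        using finite_S A by (intro sum.mono_neutral_cong_right) (auto simp: indicator_def)
      finally show "\<pi> y * h t y = (\<Sum>x\<in>A. \<pi> x * P t x y)" .
    qed
    also have "\<dots> = (\<Sum>x\<in>A. \<pi> x * sum (P t x) (S - A))"
      by (subst sum.swap) (simp add: sum_distrib_left)
    finally show ?thesis .
  qed
  ultimately show ?thesis by (simp add: mult_ac)
qed

lemma tv_ge: "B \<subseteq> S \<Longrightarrow> \<bar>sum p B - sum q B\<bar> \<le> tv_dist S p q"
  unfolding tv_dist_def using finite_S by (intro Max_ge) auto

text \<open>The complement of \<open>A\<close> has stationary mass at least 1/2, so once the chain
  has mixed, every start in \<open>A\<close> has escaped with probability at least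
  \<open>1 / 2 - \<epsilon>\<close>. Averaging over \<open>A\<close> with weights \<pi> meets
  \<open>escape_bound\<close>.\<close>

lemma mixing_lower_bound:
  assumes A: "A \<subseteq> S" and "sum \<pi> A \<le> 1 / 2" and t: "0 \<le> t"
    and flow: "\<And>x y. x \<in> A \<Longrightarrow> y \<in> S - A \<Longrightarrow> \<pi> x * Q x y \<le> b" and "0 \<le> b"
    and mix: "\<And>x. x \<in> S \<Longrightarrow> tv_dist S (P t x) \<pi> \<le> \<epsilon>"
  shows "sum \<pi> A * (1 / 2 - \<epsilon>) \<le> t * (b * (real (card S))\<^sup>2)"
proof -
  have "sum \<pi> (S - A) \<ge> 1 / 2" using assms(2) sum_pi finite_S A by (simp add: sum_diff)
  then have "1 / 2 - \<epsilon> \<le> sum (P t x) (S - A)" if "x \<in> A" for x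
    using mix[of x] tv_ge[of "S - A" "P t x" \<pi>] that A by fastforce
  then have "(\<Sum>x\<in>A. \<pi> x * (1 / 2 - \<epsilon>)) \<le> (\<Sum>x\<in>A. \<pi> x * sum (P t x) (S - A))"
    using A pi_pos by (intro sum_mono mult_left_mono) (auto intro!: less_imp_le)
  also have "\<dots> \<le> t * (b * (real (card S))\<^sup>2)" by (rule escape_bound[OF A t flow \<open>0 \<le> b\<close>])
  finally show ?thesis by (simp add: sum_distrib_right)
qed

section \<open>Exponential decay from a Poincare inequality\<close>

lemma variance_decay:
  assumes poincare: "\<And>f. (\<Sum>y\<in>S. \<pi> y * f y) = 0 \<Longrightarrow> r * (\<Sum>y\<in>S. \<pi> y * (f y)\<^sup>2) \<le> dirichlet f f"
    and h: "heat_solution h" and mean: "(\<Sum>y\<in>S. \<pi> y * h 0 y) = 0" and t: "0 \<le> t"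
  shows "(\<Sum>y\<in>S. \<pi> y * (h t y)\<^sup>2) \<le> exp (- 2 * r * t) * (\<Sum>y\<in>S. \<pi> y * (h 0 y)\<^sup>2)"
proof -
  \<comment> \<open>The Dirichlet form against a constant is zero, so the mean stays 0 and the
    Poincare inequality applies at every time.\<close>
  have mean_t: "(\<Sum>y\<in>S. \<pi> y * h t y) = 0" for t
  proof -
    have "((\<lambda>t. \<Sum>y\<in>S. \<pi> y * 1 * h t y) has_real_derivative 0) (at t)" for t
      using heat_mean_deriv[OF h, of "\<lambda>_. 1" t] by (simp add: dirichlet_def)
    from DERIV_const_ratio_const[OF _ this, of t 0] show ?thesis
      using mean by (cases "t = 0") (auto simp: field_simps)
  qed
  define V where "V t = (\<Sum>y\<in>S. \<pi> y * (h t y)\<^sup>2)" for t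
  have dV: "(V has_real_derivative - 2 * dirichlet (h t) (h t)) (at t)" for t
  proof -
    have "(V has_real_derivative
        (\<Sum>y\<in>S. \<pi> y * (2 * h t y * (\<Sum>z\<in>S. Q y z * h t z)))) (at t)"
      unfolding V_def
      proof (intro DERIV_sum DERIV_cmult)
      fix y assume "y \<in> S"
      from DERIV_power[OF heat_solutionD[OF h this], of 2]
      show "((\<lambda>t. (h t y)\<^sup>2) has_real_derivative 2 * h t y * (\<Sum>z\<in>S. Q y z * h t z)) (at t)"
        by (simp add: mult_ac)
    qed
    moreover have "(\<Sum>y\<in>S. \<pi> y * (2 * h t y * (\<Sum>z\<in>S. Q y z * h t z))) = 2 * - dirichlet (h t) (h t)"
      unfolding green[symmetric] by (simp only: sum_distrib_left mult_ac)
    ultimately show ?thesis by simp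
  qed
  \<comment> \<open>The exponential is an integrating factor for the differential inequality
    \<open>V' \<le> - 2 * r * V\<close>.\<close>
  have "exp (2 * r * t) * V t \<le> exp (2 * r * 0) * V 0"
  proof (rule DERIV_nonpos_imp_nonincreasing[OF t])
    fix s :: real
    have "((\<lambda>t. exp (2 * r * t)) has_real_derivative exp (2 * r * s) * (2 * r * 1)) (at s)"
      by (intro DERIV_fun_exp DERIV_cmult DERIV_ident)
    from DERIV_mult[OF this dV[of s]]
    have "((\<lambda>t. exp (2 * r * t) * V t) has_real_derivative
        exp (2 * r * s) * (2 * r * V s - 2 * dirichlet (h s) (h s))) (at s)"
      by (simp add: algebra_simps)
    moreover have "exp (2 * r * s) * (2 * r * V s - 2 * dirichlet (h s) (h s)) \<le> 0"
      using poincare[OF mean_t, of s] by (intro mult_nonneg_nonpos) (auto simp: V_def)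
    ultimately show "\<exists>D. ((\<lambda>t. exp (2 * r * t) * V t) has_real_derivative D) (at s) \<and> D \<le> 0"
      by blast
  qed
  then have "exp (- 2 * r * t) * (exp (2 * r * t) * V t) \<le> exp (- 2 * r * t) * V 0"
    by (intro mult_left_mono) auto
  then show ?thesis unfolding V_def by (simp add: mult.assoc[symmetric] exp_add[symmetric])
qed

text \<open>The relative density minus one has mean 0 and initial variance
  \<open>1 / \<pi> x - 1\<close>. Its variance decays, and Cauchy-Schwarz turns the variance into a
  bound valid for every event.\<close>

lemma tv_decay:
  assumes poincare: "\<And>f. (\<Sum>y\<in>S. \<pi> y * f y) = 0 \<Longrightarrow> r * (\<Sum>y\<in>S. \<pi> y * (f y)\<^sup>2) \<le> dirichlet f f"
    and x: "x \<in> S" and t: "0 \<le> t"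
  shows "(tv_dist S (P t x) \<pi>)\<^sup>2 \<le> exp (- 2 * r * t) / \<pi> x"
proof -
  \<comment> \<open>The point mass at \<open>x\<close> is written as an indicator weight to match
    \<open>heat_solution_density\<close>.\<close>
  define k where "k t y = (\<Sum>z\<in>S. indicator {x} z * P t z y) / \<pi> y" for t y
  define h where "h t y = k t y - 1" for t y
  have k: "k t y = P t x y / \<pi> y" for t y
  proof -
    have "(\<Sum>z\<in>S. indicator {x} z * P t z y) = (\<Sum>z\<in>S. if z = x then P t z y else 0)"
      by (intro sum.cong) (auto simp: indicator_def)
    then show ?thesis unfolding k_def using x finite_S by simp
  qed
  have hs: "heat_solution h"
    unfolding h_def k_def by (intro heat_solution_diff heat_solution_const heat_solution_density)
  have h: "\<pi> y * h t y = P t x y - \<pi> y" if "y \<in> S" for t y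
    unfolding h_def k using pi_pos[OF that] by (simp add: right_diff_distrib)
  have mean: "(\<Sum>y\<in>S. \<pi> y * h 0 y) = 0"
  proof -
    have "(\<Sum>y\<in>S. \<pi> y * h 0 y) = (\<Sum>y\<in>S. (if x = y then 1 else 0) - \<pi> y)"
      by (intro sum.cong refl) (simp add: h P_0)
    then show ?thesis using x finite_S sum_pi by (simp add: sum_subtractf)
  qed
  have init: "(\<Sum>y\<in>S. \<pi> y * (h 0 y)\<^sup>2) \<le> 1 / \<pi> x"
  proof -
    have "(\<Sum>y\<in>S. \<pi> y * (h 0 y)\<^sup>2) = (\<Sum>y\<in>S. (if x = y then 1 / \<pi> x - 2 else 0) + \<pi> y)"
    proof (rule sum.cong[OF refl])
      fix y assume "y \<in> S"
      have "p * (1 / p - 1)\<^sup>2 = 1 / p - 2 + p" if "p > 0" for p :: real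
        using that by (simp add: power2_eq_square field_simps)
      then show "\<pi> y * (h 0 y)\<^sup>2 = (if x = y then 1 / \<pi> x - 2 else 0) + \<pi> y"
        using pi_pos[OF \<open>y \<in> S\<close>] by (simp add: h_def k P_0)
    qed
    also have "\<dots> = 1 / \<pi> x - 1" using x finite_S sum_pi by (simp add: sum.distrib)
    finally show ?thesis by simp
  qed
  have var: "(\<Sum>y\<in>S. \<pi> y * (h t y)\<^sup>2) \<le> exp (- 2 * r * t) / \<pi> x"
    using order_trans[OF variance_decay[OF poincare hs mean t] mult_left_mono[OF init, of "exp (- 2 * r * t)"]]
    by simp
  have "\<bar>sum (P t x) B - sum \<pi> B\<bar> \<le> sqrt (exp (- 2 * r * t) / \<pi> x)" if B: "B \<subseteq> S" for B
  proof -
    have "(\<Sum>y\<in>B. \<pi> y * h t y) = (\<Sum>y\<in>B. P t x y - \<pi> y)"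
      using B by (intro sum.cong refl) (auto simp: h)
    then have "\<bar>sum (P t x) B - sum \<pi> B\<bar> = \<bar>\<Sum>y\<in>B. \<pi> y * h t y\<bar>"
      by (simp add: sum_subtractf)
    also have "\<dots> \<le> (\<Sum>y\<in>B. \<bar>\<pi> y * h t y\<bar>)" by (rule sum_abs)
    also have "\<dots> \<le> (\<Sum>y\<in>S. \<bar>\<pi> y * h t y\<bar>)" by (rule sum_mono2[OF finite_S B]) auto
    \<comment> \<open>\<open>\<pi> y\<close> is split into two square roots for Cauchy-Schwarz; the
      first factor then has norm 1.\<close>
    also have "\<dots> = (\<Sum>y\<in>S. \<bar>sqrt (\<pi> y)\<bar> * \<bar>sqrt (\<pi> y) * h t y\<bar>)"
      using pi_pos by (intro sum.cong) (auto simp: abs_mult less_imp_le)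
    also have "\<dots> \<le> L2_set (\<lambda>y. sqrt (\<pi> y)) S * L2_set (\<lambda>y. sqrt (\<pi> y) * h t y) S"
      by (rule L2_set_mult_ineq)
    also have "L2_set (\<lambda>y. sqrt (\<pi> y)) S = 1"
      using pi_pos sum_pi by (simp add: L2_set_def less_imp_le)
    also have "L2_set (\<lambda>y. sqrt (\<pi> y) * h t y) S = sqrt (\<Sum>y\<in>S. \<pi> y * (h t y)\<^sup>2)"
      using pi_pos by (simp add: L2_set_def power_mult_distrib less_imp_le)
    also have "1 * sqrt (\<Sum>y\<in>S. \<pi> y * (h t y)\<^sup>2) \<le> sqrt (exp (- 2 * r * t) / \<pi> x)"
      using var by simp
    finally show ?thesis .
  qed
  then have "tv_dist S (P t x) \<pi> \<le> sqrt (exp (- 2 * r * t) / \<pi> x)"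
    unfolding tv_dist_def using finite_S by (subst Max_le_iff) auto
  moreover have "0 \<le> tv_dist S (P t x) \<pi>" using tv_ge[of "{}" "P t x" \<pi>] by simp
  ultimately have "(tv_dist S (P t x) \<pi>)\<^sup>2 \<le> (sqrt (exp (- 2 * r * t) / \<pi> x))\<^sup>2" by (rule power_mono)
  then show ?thesis using pi_pos[OF x] by simp
qed

end

subsection \<open>Levels of separation and the communication height\<close>

definition activates :: "nat \<Rightarrow> nat \<Rightarrow> state \<Rightarrow> state \<Rightarrow> bool" where
  "activates N C x y \<longleftrightarrow> (\<exists>i\<in>{1..N}. \<exists>c\<in>{1..C}. x i = 0 \<and> y = x(i := c))"

text \<open>A deactivation is an activation read backwards, so one relation describes both kinds of
  step.\<close>

lemma rate_eq:
  "rate N C \<nu> x y = (if activates N C x y then \<nu> else if activates N C y x then 1 else 0)"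
proof -
  have "(\<exists>i\<in>{1..N}. \<exists>c\<in>{1..C}. x i = c \<and> y = x(i := 0)) \<longleftrightarrow> activates N C y x"
    unfolding activates_def by (intro bex_cong refl) (auto simp: fun_eq_iff)
  then show ?thesis unfolding rate_def activates_def[symmetric] by simp
qed

lemma active_activates:
  assumes "activates N C x y" shows "active N y = Suc (active N x)"
proof -
  from assms obtain i c where i: "i \<in> {1..N}" "c \<in> {1..C}" "x i = 0" "y = x(i := c)"
    unfolding activates_def by blast
  then have "{j \<in> {1..N}. y j \<noteq> 0} = insert i {j \<in> {1..N}. x j \<noteq> 0}" by auto
  then show ?thesis unfolding active_def using i by simp
qed

text \<open>A step up gains the factor \<nu> and thereby reaches the power of the larger activity; a
  step down already starts there. The symmetry of the result is detailed balance.\<close>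

lemma weight_eq:
  "\<nu> ^ active N x * rate N C \<nu> x y =
    (if activates N C x y \<or> activates N C y x then \<nu> ^ max (active N x) (active N y) else 0)"
proof -
  consider "activates N C x y" | "\<not> activates N C x y" "activates N C y x"
    | "\<not> activates N C x y" "\<not> activates N C y x" by blast
  then show ?thesis by cases (simp_all add: rate_eq active_activates max_def)
qed

lemma not_activates_refl: "\<not> activates N C x x"
  using active_activates[of N C x x] by auto

section \<open>Feasible states\<close>

locale activity_process =
  fixes N C :: nat and E :: "nat \<Rightarrow> (nat \<times> nat) set"
  assumes N_pos: "1 \<le> N" and C_pos: "1 \<le> C"
    and simple_graph: "\<And>c. c \<in> {1..C} \<Longrightarrow> simple_graph_on {1..N} (E c)"
begin

lemma edgeD:
  assumes "c \<in> {1..C}" "(i, j) \<in> E c"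
  shows "i \<in> {1..N}" "j \<in> {1..N}" "i \<noteq> j"
proof -
  have "E c \<subseteq> {1..N} \<times> {1..N}" "irrefl (E c)"
    using simple_graph[OF assms(1)] unfolding simple_graph_on_def by blast+
  then show "i \<in> {1..N}" "j \<in> {1..N}" "i \<noteq> j" using assms(2) unfolding irrefl_def by blast+
qed

lemma statesI:
  assumes "x \<in> {1..N} \<rightarrow>\<^sub>E {0..C}"
    and "\<And>c i j. c \<in> {1..C} \<Longrightarrow> (i, j) \<in> E c \<Longrightarrow> x i = c \<Longrightarrow> x j = c \<Longrightarrow> False"
  shows "x \<in> states N C E"
  unfolding states_def
proof (rule CollectI, intro conjI ballI)
  show "x \<in> {1..N} \<rightarrow>\<^sub>E {0..C}" by (rule assms(1))
  fix c p assume "c \<in> {1..C}" "p \<in> E c"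
  then show "case p of (i, j) \<Rightarrow> \<not> (x i = c \<and> x j = c)"
    using assms(2)[of c "fst p" "snd p"] by (simp add: case_prod_unfold) blast
qed

lemma statesD:
  assumes "x \<in> states N C E"
  shows "x \<in> {1..N} \<rightarrow>\<^sub>E {0..C}"
    and "\<And>c i j. c \<in> {1..C} \<Longrightarrow> (i, j) \<in> E c \<Longrightarrow> x i = c \<Longrightarrow> x j = c \<Longrightarrow> False"
proof -
  from assms show "x \<in> {1..N} \<rightarrow>\<^sub>E {0..C}" unfolding states_def by (elim CollectE conjE)
  from assms have *: "\<forall>c\<in>{1..C}. \<forall>(i, j)\<in>E c. \<not> (x i = c \<and> x j = c)"
    unfolding states_def by (elim CollectE conjE)
  show False if "c \<in> {1..C}" "(i, j) \<in> E c" "x i = c" "x j = c" for c i j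
  proof -
    have "case (i, j) of (i, j) \<Rightarrow> \<not> (x i = c \<and> x j = c)" by (rule bspec[OF _ that(2)]) (rule bspec[OF * that(1)])
    then show False using that(3,4) by simp
  qed
qed

lemma inactive_in_states: "(\<lambda>i\<in>{1..N}. 0) \<in> states N C E"
proof (rule statesI)
  \<comment> \<open>By \<open>edgeD\<close> the endpoint is a node, where the state is 0; elsewhere
    the value is \<open>undefined\<close> and might coincide with a channel.\<close>
  show False if "c \<in> {1..C}" "(i, j) \<in> E c" "(\<lambda>i\<in>{1..N}. 0) i = c" for c i j
    using edgeD(1)[OF that(1,2)] that(1,3) by simp
qed simp

lemma active_le_max: "x \<in> states N C E \<Longrightarrow> active N x \<le> max_active N C E"
  unfolding max_active_def by (intro Max_ge finite_imageI finite_states) auto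

lemma obtain_dominant:
  obtains x where "x \<in> states N C E" "active N x = max_active N C E"
proof -
  have "max_active N C E \<in> active N ` states N C E"
    unfolding max_active_def using inactive_in_states
    by (intro Max_in finite_imageI finite_states) auto
  then show ?thesis using that by auto
qed

lemma max_active_pos: "1 \<le> max_active N C E"
proof -
  let ?z = "\<lambda>i\<in>{1..N}. 0 :: nat"
  let ?x = "?z(1 := 1)"
  have "?x \<in> {1..N} \<rightarrow>\<^sub>E {0..C}" using N_pos C_pos by (auto simp: PiE_iff extensional_def)
  \<comment> \<open>Only node 1 carries a channel, so a violated constraint would be a loop there,
    excluded by irreflexivity.\<close>
  moreover have "i = 1" if "?x i = c" "c \<in> {1..C}" "i \<in> {1..N}" for i c
    using that by (auto split: if_splits)
  then have False if "c \<in> {1..C}" "(i, j) \<in> E c" "?x i = c" "?x j = c" for c i j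
    using that edgeD[OF that(1,2)] by metis
  ultimately have x: "?x \<in> states N C E" by (rule statesI)
  have "activates N C ?z ?x" using N_pos C_pos unfolding activates_def by (intro bexI[of _ 1]) auto
  from active_activates[OF this] active_le_max[OF x] show ?thesis by linarith
qed

lemma deactivate:
  assumes "x \<in> states N C E" "active N x \<noteq> 0"
  obtains y where "y \<in> states N C E" "activates N C y x"
proof -
  obtain i where i: "i \<in> {1..N}" "x i \<noteq> 0"
    using assms(2) unfolding active_def by (auto dest!: card_gt_0_iff[THEN iffD1, OF neq0_conv[THEN iffD1]])
  have "x i \<in> {0..C}" using statesD(1)[OF assms(1)] i(1) by (rule PiE_mem)
  then have "activates N C (x(i := 0)) x" unfolding activates_def
    using i by (intro bexI[of _ i] bexI[of _ "x i"]) auto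
  moreover have "x(i := 0) \<in> states N C E"
  proof (rule statesI)
    show "x(i := 0) \<in> {1..N} \<rightarrow>\<^sub>E {0..C}"
      using statesD(1)[OF assms(1)] i(1) unfolding PiE_iff extensional_def by simp
    show False if "c \<in> {1..C}" "(a, b) \<in> E c" "(x(i := 0)) a = c" "(x(i := 0)) b = c" for c a b
      using statesD(2)[OF assms(1) that(1,2)] that by (auto split: if_splits)
  qed
  ultimately show ?thesis using that by blast
qed

section \<open>Links, separation levels and the depth\<close>

definition link :: "nat \<Rightarrow> (state \<times> state) set" where
  "link k = {(x, y). x \<in> states N C E \<and> y \<in> states N C E \<and>
    (activates N C x y \<or> activates N C y x) \<and> k \<le> max (active N x) (active N y)}"

lemma sym_link: "sym (link k)"
  unfolding sym_def link_def by (auto simp: max.commute)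

lemma link_subset: "link k \<subseteq> states N C E \<times> states N C E"
  unfolding link_def by auto

lemma link_above_max: "max_active N C E < k \<Longrightarrow> link k = {}"
  unfolding link_def by (auto simp: max_def dest!: active_le_max split: if_splits)

text \<open>Level 0 admits every link, and every state reaches the state without active nodes by
  successive deactivations.\<close>

lemma link_connected:
  assumes "x \<in> states N C E" "y \<in> states N C E"
  shows "(x, y) \<in> (link 0)\<^sup>*"
proof -
  let ?z = "\<lambda>i\<in>{1..N}. 0 :: nat"
  have to_inactive: "(x, ?z) \<in> (link 0)\<^sup>*" if "x \<in> states N C E" for x
    using that
  proof (induction "active N x" arbitrary: x)
    case 0
    then have "x = ?z"
      unfolding active_def states_def by (auto simp: fun_eq_iff PiE_iff extensional_def)
    then show ?case by simp
  next
    case (Suc n)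
    then obtain y where y: "y \<in> states N C E" "activates N C y x" using deactivate[of x] by auto
    then have "(y, ?z) \<in> (link 0)\<^sup>*"
      using Suc active_activates[OF y(2)] by simp
    moreover have "(x, y) \<in> link 0" using y Suc.prems unfolding link_def by simp
    ultimately show ?case by (rule converse_rtrancl_into_rtrancl[rotated])
  qed
  have "(?z, y) \<in> (link 0)\<^sup>*"
    by (rule symD[OF sym_rtrancl[OF sym_link] to_inactive[OF assms(2)]])
  with to_inactive[OF assms(1)] show ?thesis by (rule rtrancl_trans)
qed

text \<open>\<open>link (Suc k)\<close> keeps the links of level above \<open>k\<close>. Bounding
  \<open>k\<close> makes the set finite, and at the largest \<open>k\<close> no links
  remain.\<close>

definition separated :: "(state \<times> state \<times> nat) set" where
  "separated = {(x, y, k). x \<in> states N C E \<and> y \<in> states N C E \<and>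
    k \<le> max_active N C E \<and> (x, y) \<notin> (link (Suc k))\<^sup>*}"

text \<open>The number \<open>M\<close> of the overview: the largest exponent of \<nu> when the
  unnormalised weights of \<open>x\<close> and \<open>y\<close> are multiplied and divided by the
  bottleneck weight \<open>\<nu> ^ k\<close>.\<close>

definition depth :: real where
  "depth = Max ((\<lambda>(x, y, k). real (active N x) + real (active N y) - real k) ` separated)"

lemma finite_separated: "finite (separated)"
  by (rule finite_subset[of _ "states N C E \<times> states N C E \<times> {..max_active N C E}"])
    (auto simp: separated_def intro!: finite_states)

lemma depth_ge:
  "(x, y, k) \<in> separated \<Longrightarrow> real (active N x) + real (active N y) - real k \<le> depth"
  unfolding depth_def by (intro Max_ge finite_imageI finite_separated) force

text \<open>No link lies above the maximal activity. Hence \<open>separated\<close> is nonempty, and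
  every distinct pair has a least separating level.\<close>

lemma distinct_separated:
  assumes "x \<in> states N C E" "y \<in> states N C E" "x \<noteq> y"
  shows "(x, y, max_active N C E) \<in> separated"
  using assms unfolding separated_def by (simp add: link_above_max)

lemma obtain_depth:
  obtains x y k where "(x, y, k) \<in> separated"
    "depth = real (active N x) + real (active N y) - real k"
proof -
  obtain x where x: "x \<in> states N C E" "active N x = max_active N C E" by (rule obtain_dominant)
  obtain y where y: "y \<in> states N C E" "activates N C y x" using deactivate[OF x(1)] x(2) max_active_pos by auto
  then have "x \<noteq> y" using not_activates_refl by auto
  then have "separated \<noteq> {}" using distinct_separated x(1) y(1) by blast
  then have "depth \<in> (\<lambda>(x, y, k). real (active N x) + real (active N y) - real k) ` separated"
    unfolding depth_def by (intro Max_in finite_imageI finite_separated) auto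
  then show ?thesis using that by auto
qed

section \<open>Paths and the communication height\<close>

lemma is_path_Cons:
  assumes "(x, x') \<in> link k" "is_path N C E x' \<omega> y"
  shows "is_path N C E x (x # \<omega>) y"
proof -
  have "0 < rate N C \<nu> ((x # \<omega>) ! j) ((x # \<omega>) ! Suc j)"
    if "Suc j < length (x # \<omega>)" "1 < \<nu>" for j \<nu>
  proof (cases j)
    case 0
    have "\<omega> ! 0 = x'" using assms(2) by (auto simp: is_path_def hd_conv_nth)
    moreover have "activates N C x x' \<or> activates N C x' x" using assms(1) by (simp add: link_def)
    ultimately show ?thesis using 0 \<open>1 < \<nu>\<close> by (auto simp: rate_eq)
  next
    case (Suc i)
    then show ?thesis using assms(2) that by (auto simp: is_path_def)
  qed
  then show ?thesis using assms by (auto simp: is_path_def link_def)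
qed

text \<open>The ends of a link differ by one in activity, so a link of level at least
  \<open>k\<close> has both ends at \<open>k - 1\<close> or more; \<open>Suc\<close> avoids the
  subtraction. The assumption on \<open>y\<close> covers the path of length one.\<close>

lemma obtain_path:
  assumes "(x, y) \<in> (link k)\<^sup>*" "y \<in> states N C E" "k \<le> Suc (active N y)"
  shows "\<exists>\<omega>. is_path N C E x \<omega> y \<and> (\<forall>z\<in>set \<omega>. k \<le> Suc (active N z))"
  using assms(1)
proof (induction rule: converse_rtrancl_induct)
  case base
  then show ?case using assms by (intro exI[of _ "[y]"]) (auto simp: is_path_def)
next
  case (step x x')
  then obtain \<omega> where "is_path N C E x' \<omega> y" "\<forall>z\<in>set \<omega>. k \<le> Suc (active N z)" by blast
  moreover have "k \<le> Suc (active N x)"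
    using step.hyps(1) by (auto simp: link_def dest: active_activates)
  ultimately show ?case using is_path_Cons[OF step.hyps(1)] by (intro exI[of _ "x # \<omega>"]) auto
qed

lemma finite_path_heights: "finite {path_height N C E \<omega> |\<omega>. is_path N C E x \<omega> y}"
proof (rule finite_subset)
  show "{path_height N C E \<omega> |\<omega>. is_path N C E x \<omega> y} \<subseteq> {..max_active N C E}"
    by (auto simp: path_height_def is_path_def)
qed simp

lemma comm_height_le:
  assumes "is_path N C E x \<omega> y" "\<And>z. z \<in> set \<omega> \<Longrightarrow> max_active N C E - active N z \<le> h"
  shows "comm_height N C E x y \<le> h"
proof -
  have "comm_height N C E x y \<le> path_height N C E \<omega>"
    unfolding comm_height_def using assms(1) by (intro Min_le finite_path_heights) auto
  also have "\<dots> \<le> h"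
    using assms unfolding path_height_def is_path_def by (subst Max_le_iff) auto
  finally show ?thesis .
qed

lemma finite_dominant: "finite (dominant N C E)"
  unfolding dominant_def by (simp add: finite_states)

lemma worst_height_eq:
  "worst_height N C E = Max ((\<lambda>(s, s'). comm_height N C E s s') ` (dominant N C E \<times> dominant N C E))"
  unfolding worst_height_def by (rule arg_cong[of _ _ Max]) auto

text \<open>A path between distinct states has a first step. That step changes the activity, so one
  of its ends lies below the maximum.\<close>

lemma comm_height_pos:
  assumes s: "s \<in> dominant N C E" "s' \<in> dominant N C E" "s \<noteq> s'"
  shows "1 \<le> comm_height N C E s s'"
proof -
  have "(s, s') \<in> (link 0)\<^sup>*" using s by (intro link_connected) (auto simp: dominant_def)
  then obtain \<omega>\<^sub>0 where "is_path N C E s \<omega>\<^sub>0 s'" using obtain_path[of s s' 0] s by (auto simp: dominant_def)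
  then have "comm_height N C E s s' \<in> {path_height N C E \<omega> |\<omega>. is_path N C E s \<omega> s'}"
    unfolding comm_height_def by (intro Min_in finite_path_heights) auto
  then obtain \<omega> where \<omega>: "is_path N C E s \<omega> s'" "comm_height N C E s s' = path_height N C E \<omega>" by auto
  then obtain x y \<omega>' where xy: "\<omega> = x # y # \<omega>'"
    using s(3) unfolding is_path_def by (metis last_ConsL list.collapse list.exhaust list.sel(1))
  \<comment> \<open>The path condition holds for all rates above 1; the value 2 is a sample.\<close>
  then have "rate N C 2 x y > 0" using \<omega>(1) unfolding is_path_def by (auto dest!: spec[of _ "0::nat"] spec[of _ "2::real"])
  then have "active N x \<noteq> active N y"
    by (auto simp: rate_eq split: if_splits dest: active_activates)
  moreover have "active N z \<le> max_active N C E" if "z \<in> set \<omega>" for z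
    using \<omega>(1) that active_le_max unfolding is_path_def by blast
  ultimately obtain z where z: "z \<in> set \<omega>" "active N z < max_active N C E"
    using xy by (metis list.set_intros(1,2) nat_less_le)
  then have "max_active N C E - active N z \<le> path_height N C E \<omega>"
    unfolding path_height_def by (intro Max_ge) auto
  then show ?thesis using z \<omega>(2) by linarith
qed

lemma worst_height_pos:
  assumes "2 \<le> card (dominant N C E)" shows "1 \<le> worst_height N C E"
proof -
  obtain s s' where s: "s \<in> dominant N C E" "s' \<in> dominant N C E" "s \<noteq> s'"
    using assms card_le_Suc0_iff_eq[OF finite_dominant] by fastforce
  have "1 \<le> comm_height N C E s s'" by (rule comm_height_pos[OF s])
  also have "\<dots> \<le> worst_height N C E"
    unfolding worst_height_eq using s finite_dominant by (intro Max_ge) force+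
  finally show ?thesis .
qed

text \<open>With \<open>A\<close> the maximal activity, a pair attaining \<Gamma> > 0 is separated
  at level \<open>A - \<Gamma> + 1\<close> and contributes
  \<open>A + A - (A - \<Gamma> + 1) = A + \<Gamma> - 1\<close> to the depth.\<close>

lemma worst_height_le_depth:
  "real (worst_height N C E) - 1 \<le> depth - max_active N C E"
proof -
  let ?A = "max_active N C E" and ?\<Gamma> = "worst_height N C E"
  obtain x where x: "x \<in> states N C E" "active N x = ?A" by (rule obtain_dominant)
  then have "x \<in> dominant N C E" by (simp add: dominant_def)
  then have "?\<Gamma> \<in> (\<lambda>(s, s'). comm_height N C E s s') ` (dominant N C E \<times> dominant N C E)"
    unfolding worst_height_eq using finite_dominant by (intro Max_in) auto
  then obtain s s' where s: "s \<in> dominant N C E" "s' \<in> dominant N C E" "?\<Gamma> = comm_height N C E s s'"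
    by auto
  show ?thesis
  proof (cases "?\<Gamma> = 0")
    case True
    \<comment> \<open>\<open>y\<close> has one active node fewer than \<open>x\<close>, and the
      maximal level separates them, so the depth is at least the maximal activity minus 1.\<close>
    obtain y where y: "y \<in> states N C E" "activates N C y x" using deactivate[OF x(1)] x(2) max_active_pos by auto
    then have "x \<noteq> y" using not_activates_refl by auto
    from depth_ge[OF distinct_separated[OF x(1) y(1) this]] show ?thesis
      using True active_activates[OF y(2)] x(2) by simp
  next
    case False
    \<comment> \<open>This makes the subtraction \<open>?A - ?\<Gamma>\<close> of natural numbers
      exact.\<close>
    have le: "?\<Gamma> \<le> ?A"
    proof -
      have "(s, s') \<in> (link 0)\<^sup>*" using s by (intro link_connected) (auto simp: dominant_def)
      then obtain \<omega> where "is_path N C E s \<omega> s'" using obtain_path[of s s' 0] s by (auto simp: dominant_def)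
      then show ?thesis unfolding s(3) by (rule comm_height_le) simp
    qed
    \<comment> \<open>One \<open>Suc\<close> belongs to the level \<open>?A - ?\<Gamma> + 1\<close>,
      the other to the definition of \<open>separated\<close>. A connection would give a path of
      height at most \<open>?\<Gamma> - 1\<close>.\<close>
    have "(s, s') \<notin> (link (Suc (Suc (?A - ?\<Gamma>))))\<^sup>*"
    proof
      assume "(s, s') \<in> (link (Suc (Suc (?A - ?\<Gamma>))))\<^sup>*"
      moreover have "s' \<in> states N C E" "Suc (Suc (?A - ?\<Gamma>)) \<le> Suc (active N s')"
        using s(2) False le by (auto simp: dominant_def)
      ultimately obtain \<omega> where
        "is_path N C E s \<omega> s'" and \<omega>: "\<And>z. z \<in> set \<omega> \<Longrightarrow> Suc (Suc (?A - ?\<Gamma>)) \<le> Suc (active N z)"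
        using obtain_path by blast
      from this(1) have "comm_height N C E s s' \<le> ?\<Gamma> - 1"
        by (rule comm_height_le) (use \<omega> in fastforce)
      then show False using s(3) False by simp
    qed
    then have "(s, s', Suc (?A - ?\<Gamma>)) \<in> separated"
      using s False le unfolding separated_def dominant_def by auto
    from depth_ge[OF this] show ?thesis using s le by (simp add: dominant_def of_nat_diff)
  qed
qed

end

subsection \<open>Asymptotics of the mixing time\<close>

text \<open>After division by \<open>ln \<nu>\<close> the constants vanish, and the logarithmic
  factor leaves only \<open>ln (ln \<nu>) / ln \<nu>\<close>, which tends to 0.\<close>

lemma log_tendsto_of_bounds:
  fixes t :: "real \<Rightarrow> real"
  assumes "0 < c" "0 < K" "0 < B"
    and lower: "\<And>\<nu>. 1 < \<nu> \<Longrightarrow> c * \<nu> powr m \<le> t \<nu>"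
    and upper: "\<And>\<nu>. 1 < \<nu> \<Longrightarrow> t \<nu> \<le> K * \<nu> powr m * ln (B * \<nu> ^ n)"
  shows "((\<lambda>\<nu>. log \<nu> (t \<nu>)) \<longlongrightarrow> m) at_top"
proof (rule tendsto_sandwich)
  \<comment> \<open>Once \<open>ln \<nu> \<ge> 1\<close>, the factor
    \<open>ln (B * \<nu> ^ n)\<close> is at most the bracket times \<open>ln \<nu>\<close>. The
    summand 1 keeps \<open>D\<close> positive.\<close>
  define D where "D = K * (\<bar>ln B\<bar> + real n + 1)"
  have "0 < D" unfolding D_def using \<open>0 < K\<close> by (intro mult_pos_pos) auto
  have large: "\<forall>\<^sub>F \<nu> :: real in at_top. exp 1 \<le> \<nu>" by (rule eventually_ge_at_top)
  have ln_ge: "1 < \<nu>" "1 \<le> ln \<nu>" if "exp 1 \<le> \<nu>" for \<nu> :: real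
  proof -
    show "1 < \<nu>" using that less_le_trans[of 1 "exp 1" \<nu>] by simp
    then show "1 \<le> ln \<nu>" using that by (simp add: ln_ge_iff)
  qed
  show "\<forall>\<^sub>F \<nu> in at_top. ln c / ln \<nu> + m \<le> log \<nu> (t \<nu>)"
    using large
  proof eventually_elim
    case (elim \<nu>)
    note \<nu> = ln_ge[OF elim]
    have "0 < c * \<nu> powr m" using \<open>0 < c\<close> \<nu>(1) by simp
    then have "ln (c * \<nu> powr m) \<le> ln (t \<nu>)" using lower[OF \<nu>(1)] by simp
    moreover have "ln (c * \<nu> powr m) = ln c + m * ln \<nu>"
      using \<open>0 < c\<close> \<nu>(1) by (simp add: ln_mult ln_powr)
    ultimately have "(ln c + m * ln \<nu>) / ln \<nu> \<le> log \<nu> (t \<nu>)"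
      unfolding log_def using \<nu>(2) by (intro divide_right_mono) auto
    then show ?case using \<nu>(2) by (simp add: add_divide_distrib)
  qed
  show "\<forall>\<^sub>F \<nu> in at_top. log \<nu> (t \<nu>) \<le> ln D / ln \<nu> + m + ln (ln \<nu>) / ln \<nu>"
    using large
  proof eventually_elim
    case (elim \<nu>)
    note \<nu> = ln_ge[OF elim]
    have "0 < c * \<nu> powr m" using \<open>0 < c\<close> \<nu>(1) by simp
    then have t_pos: "0 < t \<nu>" using lower[OF \<nu>(1)] by simp
    have "ln (B * \<nu> ^ n) = ln B + real n * ln \<nu>"
      using \<open>0 < B\<close> \<nu>(1) by (simp add: ln_mult ln_realpow)
    also have "\<dots> \<le> \<bar>ln B\<bar> * ln \<nu> + real n * ln \<nu> + ln \<nu>"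
      using mult_left_mono[OF \<nu>(2), of "\<bar>ln B\<bar>"] \<nu>(2) by simp
    finally have "ln (B * \<nu> ^ n) \<le> (\<bar>ln B\<bar> + real n + 1) * ln \<nu>" by (simp add: algebra_simps)
    then have "K * \<nu> powr m * ln (B * \<nu> ^ n) \<le> K * \<nu> powr m * ((\<bar>ln B\<bar> + real n + 1) * ln \<nu>)"
      using \<open>0 < K\<close> by (intro mult_left_mono) auto
    then have "t \<nu> \<le> D * \<nu> powr m * ln \<nu>"
      using upper[OF \<nu>(1)] unfolding D_def by (simp add: mult_ac)
    then have "ln (t \<nu>) \<le> ln (D * \<nu> powr m * ln \<nu>)" using t_pos by simp
    moreover have "ln (D * \<nu> powr m * ln \<nu>) = ln D + m * ln \<nu> + ln (ln \<nu>)"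
      using \<open>0 < D\<close> \<nu> by (simp add: ln_mult ln_powr)
    ultimately have "log \<nu> (t \<nu>) \<le> (ln D + m * ln \<nu> + ln (ln \<nu>)) / ln \<nu>"
      unfolding log_def using \<nu>(2) by (intro divide_right_mono) auto
    then show ?case using \<nu>(2) by (simp add: add_divide_distrib)
  qed
  have const: "((\<lambda>\<nu>::real. a / ln \<nu>) \<longlongrightarrow> 0) at_top" for a
    by (rule tendsto_divide_0[OF tendsto_const filterlim_at_top_imp_at_infinity[OF ln_at_top]])
  show "((\<lambda>\<nu>. ln c / ln \<nu> + m) \<longlongrightarrow> m) at_top"
    using tendsto_add[OF const[of "ln c"] tendsto_const[of m]] by simp
  have "((\<lambda>\<nu>::real. ln (ln \<nu>) / ln \<nu>) \<longlongrightarrow> 0) at_top"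
    by (rule filterlim_compose[OF ln_x_over_x_tendsto_0 ln_at_top])
  from tendsto_add[OF tendsto_add[OF const[of "ln D"] tendsto_const[of m]] this]
  show "((\<lambda>\<nu>. ln D / ln \<nu> + m + ln (ln \<nu>) / ln \<nu>) \<longlongrightarrow> m) at_top" by simp
qed

context activity_process
begin

section \<open>Stationary law and partition function\<close>

definition partition_fun :: "real \<Rightarrow> real" where
  "partition_fun \<nu> = (\<Sum>y\<in>states N C E. \<nu> ^ active N y)"

lemma stationary_eq: "stationary N C E \<nu> x = \<nu> ^ active N x / partition_fun \<nu>"
  unfolding stationary_def partition_fun_def by simp

lemma partition_fun_ge:
  assumes "1 < \<nu>" shows "\<nu> ^ max_active N C E \<le> partition_fun \<nu>"
proof -
  obtain x where x: "x \<in> states N C E" "active N x = max_active N C E" by (rule obtain_dominant)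
  then have "\<nu> ^ active N x \<le> partition_fun \<nu>"
    unfolding partition_fun_def using assms by (intro member_le_sum finite_states) auto
  then show ?thesis using x by simp
qed

lemma partition_fun_pos: "1 < \<nu> \<Longrightarrow> 0 < partition_fun \<nu>"
  using partition_fun_ge[of \<nu>] zero_less_power[of \<nu> "max_active N C E"] by linarith

text \<open>Together with \<open>partition_fun_ge\<close> this fixes the order of the partition
  function, the source of \<open>- max_active N C E\<close> in the exponent of the mixing
  time.\<close>

lemma partition_fun_le:
  assumes "1 < \<nu>"
  shows "partition_fun \<nu> \<le> real (card (states N C E)) * \<nu> ^ max_active N C E"
  unfolding partition_fun_def using assms
  by (intro sum_bounded_above power_increasing active_le_max) auto

lemma card_states_pos: "1 \<le> real (card (states N C E))"
proof -
  have "card (states N C E) \<noteq> 0" using inactive_in_states finite_states by (auto simp: card_eq_0_iff)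
  then show ?thesis by linarith
qed

lemma stationary_generator:
  assumes "x \<noteq> y"
  shows "stationary N C E \<nu> x * generator N C E \<nu> x y =
    (if activates N C x y \<or> activates N C y x then \<nu> ^ max (active N x) (active N y) else 0) / partition_fun \<nu>"
  unfolding stationary_eq generator_def weight_eq[symmetric] using assms by simp

lemma reversible_chain_activity:
  assumes \<nu>: "1 < \<nu>"
  shows "reversible_chain (states N C E) (stationary N C E \<nu>) (generator N C E \<nu>) (transition N C E \<nu>)"
proof
  show "finite (states N C E)" by (rule finite_states)
  show "0 < stationary N C E \<nu> x" for x
    unfolding stationary_eq using \<nu> partition_fun_pos[OF \<nu>] by simp
  show "sum (stationary N C E \<nu>) (states N C E) = 1"
    unfolding stationary_eq sum_divide_distrib[symmetric] partition_fun_def[symmetric]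
    using partition_fun_pos[OF \<nu>] by simp
  show "0 \<le> generator N C E \<nu> x y" if "x \<noteq> y" for x y
    using \<nu> that unfolding generator_def rate_eq by simp
  show "stationary N C E \<nu> x * generator N C E \<nu> x y = stationary N C E \<nu> y * generator N C E \<nu> y x" for x y
  proof (cases "x = y")
    case False
    then show ?thesis
      using stationary_generator[OF False] stationary_generator[OF False[symmetric]]
      by (simp add: max.commute disj_commute)
  qed simp
  show "(\<Sum>y\<in>states N C E. generator N C E \<nu> x y) = 0" if "x \<in> states N C E" for x
  proof -
    have "(\<Sum>y\<in>states N C E. generator N C E \<nu> x y) =
        generator N C E \<nu> x x + (\<Sum>y\<in>states N C E - {x}. generator N C E \<nu> x y)"
      by (rule sum.remove[OF finite_states that])
    also have "(\<Sum>y\<in>states N C E - {x}. generator N C E \<nu> x y) = (\<Sum>y\<in>states N C E - {x}. rate N C \<nu> x y)"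
      by (intro sum.cong refl) (auto simp: generator_def)
    finally show ?thesis by (simp add: generator_def)
  qed
  show "transition N C E \<nu> 0 x y = (if x = y then 1 else 0)" for x y by (rule transition_0)
  show "((\<lambda>t. transition N C E \<nu> t x y) has_real_derivative
      (\<Sum>z\<in>states N C E. transition N C E \<nu> t x z * generator N C E \<nu> z y)) (at t)"
    if "y \<in> states N C E" for x y t
    by (rule transition_forward[OF that])
qed

lemma mix_dist_le_iff:
  "mix_dist N C E \<nu> t \<le> \<epsilon> \<longleftrightarrow>
    (\<forall>x\<in>states N C E. tv_dist (states N C E) (transition N C E \<nu> t x) (stationary N C E \<nu>) \<le> \<epsilon>)"
  unfolding mix_dist_def using inactive_in_states finite_states[of N C E] by (subst Max_le_iff) auto

section \<open>Lower bound for the mixing time\<close>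

lemma separated_cut:
  assumes "(x, y, k) \<in> separated"
  obtains A where "A \<subseteq> states N C E" "x \<in> A" "y \<in> states N C E - A"
    "\<And>u v. u \<in> A \<Longrightarrow> v \<in> states N C E - A \<Longrightarrow> activates N C u v \<or> activates N C v u \<Longrightarrow>
      max (active N u) (active N v) \<le> k"
proof
  \<comment> \<open>The component of \<open>x\<close> in the graph of links above level
    \<open>k\<close>; such a link leaving it would enlarge it.\<close>
  let ?A = "{z \<in> states N C E. (x, z) \<in> (link (Suc k))\<^sup>*}"
  show "?A \<subseteq> states N C E" "x \<in> ?A" "y \<in> states N C E - ?A"
    using assms unfolding separated_def by auto
  fix u v assume uv: "u \<in> ?A" "v \<in> states N C E - ?A" "activates N C u v \<or> activates N C v u"
  show "max (active N u) (active N v) \<le> k"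
  proof (rule ccontr)
    assume "\<not> ?thesis"
    then have "(u, v) \<in> link (Suc k)" using uv unfolding link_def by auto
    then have "(x, v) \<in> (link (Suc k))\<^sup>*" using uv(1) by (auto intro: rtrancl_into_rtrancl)
    then show False using uv(2) by simp
  qed
qed

text \<open>The bottleneck bound is applied to the cut of a triple attaining the depth. Two powers
  of the number of states come from counting pairs, the third from
  \<open>partition_fun_le\<close>.\<close>

lemma mixing_time_ge:
  assumes \<nu>: "1 < \<nu>" and "\<epsilon> < 1 / 2" and t: "0 \<le> t" and mix: "mix_dist N C E \<nu> t \<le> \<epsilon>"
  shows "(1 / 2 - \<epsilon>) / real (card (states N C E)) ^ 3 * \<nu> powr (depth - max_active N C E) \<le> t"
proof -
  interpret chain: reversible_chain "states N C E" "stationary N C E \<nu>" "generator N C E \<nu>" "transition N C E \<nu>"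
    by (rule reversible_chain_activity[OF \<nu>])
  let ?X = "states N C E" and ?n = "real (card (states N C E))" and ?\<pi> = "stationary N C E \<nu>"
  let ?Z = "partition_fun \<nu>" and ?A = "max_active N C E"
  note Z = partition_fun_pos[OF \<nu>]
  obtain x y k where sep: "(x, y, k) \<in> separated"
    and depth: "depth = real (active N x) + real (active N y) - real k" by (rule obtain_depth)
  obtain A where A: "A \<subseteq> ?X" "x \<in> A" "y \<in> ?X - A"
    and cut: "\<And>u v. u \<in> A \<Longrightarrow> v \<in> ?X - A \<Longrightarrow> activates N C u v \<or> activates N C v u \<Longrightarrow>
      max (active N u) (active N v) \<le> k"
    using separated_cut[OF sep] by blast
  have flow: "?\<pi> u * generator N C E \<nu> u v \<le> \<nu> ^ k / ?Z" if "u \<in> A" "v \<in> ?X - A" for u v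
  proof -
    have "u \<noteq> v" using that by auto
    then show ?thesis
      unfolding stationary_generator[OF \<open>u \<noteq> v\<close>] using \<nu> Z cut[OF that]
      by (intro divide_right_mono) (auto intro: power_increasing)
  qed
  \<comment> \<open>Detailed balance gives the same flow in the opposite direction, so the
    complement of \<open>A\<close> can be used as well.\<close>
  have flow': "?\<pi> u * generator N C E \<nu> u v \<le> \<nu> ^ k / ?Z" if "u \<in> ?X - A" "v \<in> ?X - (?X - A)" for u v
    using flow[of v u] chain.detailed_balance[of u v] that A(1) by auto
  have single: "?\<pi> z \<le> sum ?\<pi> B" if "z \<in> B" "B \<subseteq> ?X" for z B
    using that chain.pi_pos finite_subset[OF that(2) finite_states]
    by (intro member_le_sum) (auto intro!: less_imp_le)
  have compl: "sum ?\<pi> (?X - A) = 1 - sum ?\<pi> A"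
    using chain.sum_pi A(1) by (simp add: sum_diff finite_states)
  have le1: "sum ?\<pi> A \<le> 1" "sum ?\<pi> (?X - A) \<le> 1"
    using compl single[OF A(2,1)] single[OF A(3)] chain.pi_pos[of x] chain.pi_pos[of y] A by auto
  have mix': "tv_dist ?X (transition N C E \<nu> t x) ?\<pi> \<le> \<epsilon>" if "x \<in> ?X" for x
    using mix that unfolding mix_dist_le_iff by blast
  have b0: "0 \<le> \<nu> ^ k / ?Z" using \<nu> Z by simp
  \<comment> \<open>\<open>B\<close> is chosen as a side of the cut of mass at most 1/2. Each side
    contains \<open>x\<close> or \<open>y\<close>, and the other factor is at most 1.\<close>
  obtain B where B: "sum ?\<pi> B * (1 / 2 - \<epsilon>) \<le> t * (\<nu> ^ k / ?Z * ?n\<^sup>2)"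
    and "?\<pi> x * ?\<pi> y \<le> sum ?\<pi> B"
  proof (cases "sum ?\<pi> A \<le> 1 / 2")
    case True
    have "?\<pi> x * ?\<pi> y \<le> sum ?\<pi> A * 1"
      using single[OF A(2,1)] single[OF A(3)] le1 chain.pi_pos[of x] chain.pi_pos[of y] A
      by (intro mult_mono) auto
    moreover have "sum ?\<pi> A * (1 / 2 - \<epsilon>) \<le> t * (\<nu> ^ k / ?Z * ?n\<^sup>2)"
      by (rule chain.mixing_lower_bound[OF A(1) True t flow b0 mix'])
    ultimately show ?thesis using that[of A] by simp
  next
    case False
    have "?\<pi> x * ?\<pi> y \<le> 1 * sum ?\<pi> (?X - A)"
      using single[OF A(2,1)] single[OF A(3)] le1 chain.pi_pos[of x] chain.pi_pos[of y] A
      by (intro mult_mono) auto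
    moreover have "sum ?\<pi> (?X - A) * (1 / 2 - \<epsilon>) \<le> t * (\<nu> ^ k / ?Z * ?n\<^sup>2)"
    proof (rule chain.mixing_lower_bound[OF _ _ t flow' b0 mix'])
      show "sum ?\<pi> (?X - A) \<le> 1 / 2" using False compl by simp
    qed auto
    ultimately show ?thesis using that[of "?X - A"] by simp
  qed
  then have "?\<pi> x * ?\<pi> y * (1 / 2 - \<epsilon>) \<le> t * (\<nu> ^ k / ?Z * ?n\<^sup>2)"
    using \<open>\<epsilon> < 1 / 2\<close> mult_right_mono[of "?\<pi> x * ?\<pi> y" "sum ?\<pi> B" "1 / 2 - \<epsilon>"] by linarith
  \<comment> \<open>Multiplying by \<open>?Z\<close> squared clears denominators; one
    \<open>?Z\<close> survives on the right and is bounded by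
    \<open>partition_fun_le\<close>.\<close>
  then have "?\<pi> x * ?\<pi> y * (1 / 2 - \<epsilon>) * ?Z\<^sup>2 \<le> t * (\<nu> ^ k / ?Z * ?n\<^sup>2) * ?Z\<^sup>2"
    by (rule mult_right_mono) simp
  also have "?\<pi> x * ?\<pi> y * (1 / 2 - \<epsilon>) * ?Z\<^sup>2 = \<nu> ^ active N x * \<nu> ^ active N y * (1 / 2 - \<epsilon>)"
    unfolding stationary_eq using Z by (simp add: power2_eq_square)
  also have "t * (\<nu> ^ k / ?Z * ?n\<^sup>2) * ?Z\<^sup>2 = t * \<nu> ^ k * ?n\<^sup>2 * ?Z"
    using Z by (simp add: power2_eq_square)
  also have "\<dots> \<le> t * \<nu> ^ k * ?n\<^sup>2 * (?n * \<nu> ^ ?A)"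
    using t \<nu> by (intro mult_left_mono partition_fun_le) auto
  also have "\<dots> = t * \<nu> ^ k * ?n ^ 3 * \<nu> ^ ?A"
    by (simp add: power3_eq_cube power2_eq_square)
  finally have main: "\<nu> ^ active N x * \<nu> ^ active N y * (1 / 2 - \<epsilon>) \<le> t * \<nu> ^ k * ?n ^ 3 * \<nu> ^ ?A" .
  have "\<nu> ^ active N x * \<nu> ^ active N y = \<nu> powr (depth - ?A) * (\<nu> ^ k * \<nu> ^ ?A)"
    unfolding depth using \<nu> by (simp add: powr_diff powr_add powr_realpow)
  with main have "((1 / 2 - \<epsilon>) * \<nu> powr (depth - ?A)) * (\<nu> ^ k * \<nu> ^ ?A) \<le> (t * ?n ^ 3) * (\<nu> ^ k * \<nu> ^ ?A)"
    by (simp only: mult_ac)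
  then have "(1 / 2 - \<epsilon>) * \<nu> powr (depth - ?A) \<le> t * ?n ^ 3"
    by (rule mult_right_le_imp_le) (use \<nu> in simp)
  then show ?thesis using card_states_pos by (simp add: divide_le_eq)
qed

section \<open>Poincare inequality by joining pairs along links\<close>

lemma rtrancl_link_short:
  assumes "(x, y) \<in> (link k)\<^sup>*"
  shows "\<exists>j \<le> card (states N C E) ^ 2. (x, y) \<in> link k ^^ j"
proof -
  have fin: "finite (link k)" by (rule finite_subset[OF link_subset]) (simp add: finite_states)
  have "card (link k) \<le> card (states N C E \<times> states N C E)"
    by (intro card_mono link_subset) (simp add: finite_states)
  then have le: "card (link k) \<le> card (states N C E) ^ 2" by (simp add: card_cartesian_product power2_eq_square)
  obtain j where "(x, y) \<in> link k ^^ j" using assms rtrancl_imp_relpow by blast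
  then show ?thesis
  proof (cases "j = 0")
    case False
    \<comment> \<open>A walk can be shortened to at most as many steps as there are links. The
      library fact concerns positive lengths, hence the case split.\<close>
    then have "link k ^^ j \<subseteq> (\<Union>i\<in>{i. 0 < i \<and> i \<le> card (link k)}. link k ^^ i)"
      by (intro relpow_finite_bounded1 fin) simp
    then obtain i where "i \<le> card (link k)" "(x, y) \<in> link k ^^ i"
      using \<open>(x, y) \<in> link k ^^ j\<close> by blast
    then show ?thesis using le order_trans by blast
  qed auto
qed

text \<open>On each link, the Dirichlet form bounds the squared increment weighted by
  \<open>\<nu> ^ k\<close>. The number of links used is at most the squared number of states, and
  squaring the triangle inequality produces the fourth power.\<close>

lemma difference_bound:
  fixes f :: "state \<Rightarrow> real"
  assumes \<nu>: "1 < \<nu>" and xy: "(x, y) \<in> (link k)\<^sup>*"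
  shows "\<nu> ^ k * (f x - f y)\<^sup>2 \<le> real (card (states N C E)) ^ 4 *
    (2 * partition_fun \<nu> * reversible_chain.dirichlet (states N C E) (stationary N C E \<nu>) (generator N C E \<nu>) f f)"
proof -
  interpret chain: reversible_chain "states N C E" "stationary N C E \<nu>" "generator N C E \<nu>" "transition N C E \<nu>"
    by (rule reversible_chain_activity[OF \<nu>])
  let ?X = "states N C E" and ?Z = "partition_fun \<nu>"
  let ?g = "\<lambda>u v. stationary N C E \<nu> u * generator N C E \<nu> u v * ((f u - f v) * (f u - f v))"
  define D where "D = 2 * ?Z * chain.dirichlet f f"
  note Z = partition_fun_pos[OF \<nu>]
  have g_nonneg: "0 \<le> ?g u v" if "u \<in> ?X" "v \<in> ?X" for u v
    using chain.pi_pos[of u] chain.Q_nonneg[of u v] that by (cases "u = v") auto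
  have edge: "\<nu> ^ k * (f u - f v)\<^sup>2 \<le> D" if "(u, v) \<in> link k" for u v
  proof -
    have uv: "u \<in> ?X" "v \<in> ?X" "activates N C u v \<or> activates N C v u"
      "k \<le> max (active N u) (active N v)" using that unfolding link_def by auto
    then have "u \<noteq> v" using not_activates_refl by auto
    have "\<nu> ^ k * (f u - f v)\<^sup>2 \<le> \<nu> ^ max (active N u) (active N v) * (f u - f v)\<^sup>2"
      using \<nu> uv(4) by (intro mult_right_mono power_increasing) auto
    \<comment> \<open>Up to \<open>?Z\<close> this is one of the nonnegative terms of the double sum
      in the Dirichlet form.\<close>
    also have "\<dots> = ?Z * ?g u v"
      unfolding stationary_generator[OF \<open>u \<noteq> v\<close>] using uv(3) Z by (simp add: power2_eq_square)
    also have "?g u v \<le> (\<Sum>v\<in>?X. ?g u v)"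
      using uv g_nonneg by (intro member_le_sum[of v ?X "?g u"] finite_states) auto
    also have "\<dots> \<le> (\<Sum>u\<in>?X. \<Sum>v\<in>?X. ?g u v)"
      using uv g_nonneg by (intro member_le_sum[of u ?X "\<lambda>u. \<Sum>v\<in>?X. ?g u v"] finite_states sum_nonneg) auto
    finally show ?thesis using Z unfolding D_def chain.dirichlet_def by simp
  qed
  have D0: "0 \<le> D" unfolding D_def using Z chain.dirichlet_nonneg[of f f] by simp
  define d where "d = sqrt (D / \<nu> ^ k)"
  have d0: "0 \<le> d" unfolding d_def using D0 \<nu> by simp
  have step: "\<bar>f u - f v\<bar> \<le> d" if "(u, v) \<in> link k" for u v
    unfolding d_def using edge[OF that] \<nu> by (intro real_le_rsqrt) (simp add: field_simps)
  have walk: "\<bar>f x - f z\<bar> \<le> real j * d" if "(x, z) \<in> link k ^^ j" for j z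
    using that
  proof (induction j arbitrary: z)
    case (Suc j)
    then obtain w where w: "(x, w) \<in> link k ^^ j" "(w, z) \<in> link k" by auto
    show ?case using Suc.IH[OF w(1)] step[OF w(2)] by (simp add: algebra_simps)
  qed simp
  obtain j where j: "j \<le> card ?X ^ 2" "(x, y) \<in> link k ^^ j" using rtrancl_link_short[OF xy] by blast
  have "\<bar>f x - f y\<bar> \<le> real (card ?X ^ 2) * d"
    using order_trans[OF walk[OF j(2)] mult_right_mono[OF of_nat_mono[OF j(1)] d0]] .
  then have "(f x - f y)\<^sup>2 \<le> (real (card ?X ^ 2) * d)\<^sup>2"
    by (rule power2_le_iff_abs_le[THEN iffD2, rotated]) (simp add: d0)
  also have "\<dots> = real (card ?X) ^ 4 * (D / \<nu> ^ k)"
    unfolding d_def power_mult_distrib using D0 \<nu> by (simp flip: power_mult)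
  finally show ?thesis unfolding D_def[symmetric] using \<nu> by (simp add: field_simps)
qed

text \<open>The least separating level \<open>k\<close> serves both purposes: minimality connects
  the pair by links of level at least \<open>k\<close>, and separation at \<open>k\<close> bounds
  the exponent by the depth.\<close>

lemma pair_bound:
  fixes f :: "state \<Rightarrow> real"
  assumes \<nu>: "1 < \<nu>" and xy: "x \<in> states N C E" "y \<in> states N C E"
  shows "\<nu> ^ active N x * \<nu> ^ active N y * (f x - f y)\<^sup>2 \<le> \<nu> powr depth * (real (card (states N C E)) ^ 4 *
    (2 * partition_fun \<nu> * reversible_chain.dirichlet (states N C E) (stationary N C E \<nu>) (generator N C E \<nu>) f f))"
    (is "?L \<le> \<nu> powr depth * ?R")
proof -
  interpret chain: reversible_chain "states N C E" "stationary N C E \<nu>" "generator N C E \<nu>" "transition N C E \<nu>"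
    by (rule reversible_chain_activity[OF \<nu>])
  \<comment> \<open>The trivial connection at level 0 makes the left side of
    \<open>difference_bound\<close> vanish.\<close>
  have R: "0 \<le> ?R"
    using difference_bound[OF \<nu> rtrancl_refl, where f = f and k = 0] by simp
  show ?thesis
  proof (cases "x = y")
    case True
    then show ?thesis using R by simp
  next
    case False
    define k where "k = (LEAST k. (x, y, k) \<in> separated)"
    have k: "(x, y, k) \<in> separated" unfolding k_def using distinct_separated[OF xy False] by (rule LeastI)
    have conn: "(x, y) \<in> (link k)\<^sup>*"
    proof (cases k)
      case 0
      then show ?thesis using link_connected[OF xy] by simp
    next
      case (Suc j)
      then have "(x, y, j) \<notin> separated" using not_less_Least[of j "\<lambda>k. (x, y, k) \<in> separated"] unfolding k_def by simp
      then show ?thesis using k Suc unfolding separated_def by auto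
    qed
    have "\<nu> ^ active N x * \<nu> ^ active N y = \<nu> powr (real (active N x) + real (active N y) - real k) * \<nu> ^ k"
      using \<nu> by (simp add: powr_diff powr_add powr_realpow)
    also have "\<dots> \<le> \<nu> powr depth * \<nu> ^ k"
      using \<nu> depth_ge[OF k] by (intro mult_right_mono powr_mono) auto
    finally have "?L \<le> \<nu> powr depth * \<nu> ^ k * (f x - f y)\<^sup>2" by (rule mult_right_mono) simp
    also have "\<dots> \<le> \<nu> powr depth * ?R"
      unfolding mult.assoc[of "\<nu> powr depth"]
      by (rule mult_left_mono[OF difference_bound[OF \<nu> conn]]) simp
    finally show ?thesis .
  qed
qed

text \<open>Twice the variance is a double sum of squared differences. Applying
  \<open>pair_bound\<close> to all pairs turns the fourth power of the number of states into the
  sixth.\<close>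

lemma poincare:
  fixes f :: "state \<Rightarrow> real"
  assumes \<nu>: "1 < \<nu>" and mean: "(\<Sum>y\<in>states N C E. stationary N C E \<nu> y * f y) = 0"
  shows "\<nu> powr (max_active N C E - depth) / real (card (states N C E)) ^ 6 *
      (\<Sum>y\<in>states N C E. stationary N C E \<nu> y * (f y)\<^sup>2)
    \<le> reversible_chain.dirichlet (states N C E) (stationary N C E \<nu>) (generator N C E \<nu>) f f"
proof -
  interpret chain: reversible_chain "states N C E" "stationary N C E \<nu>" "generator N C E \<nu>" "transition N C E \<nu>"
    by (rule reversible_chain_activity[OF \<nu>])
  let ?X = "states N C E" and ?n = "real (card (states N C E))" and ?\<pi> = "stationary N C E \<nu>"
  let ?Z = "partition_fun \<nu>" and ?A = "max_active N C E" and ?D = "chain.dirichlet f f"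
  note Z = partition_fun_pos[OF \<nu>]
  define V where "V = (\<Sum>y\<in>?X. ?\<pi> y * (f y)\<^sup>2)"
  have D0: "0 \<le> ?D" by (rule chain.dirichlet_nonneg) simp
  \<comment> \<open>The cross term carries the mean of \<open>f\<close> as a factor and therefore
    vanishes below.\<close>
  have "(\<Sum>x\<in>?X. \<Sum>y\<in>?X. ?\<pi> x * ?\<pi> y * (f x - f y)\<^sup>2) =
      (\<Sum>x\<in>?X. ?\<pi> x * (f x)\<^sup>2 * sum ?\<pi> ?X - 2 * (?\<pi> x * f x) * (\<Sum>y\<in>?X. ?\<pi> y * f y) + ?\<pi> x * V)"
    unfolding V_def sum_distrib_left sum.distrib[symmetric] sum_subtractf[symmetric]
    by (intro sum.cong refl) (simp add: power2_eq_square algebra_simps)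
  also have "\<dots> = 2 * V"
    using mean chain.sum_pi by (simp add: sum.distrib sum_distrib_right[symmetric] V_def)
  finally have "2 * V = (\<Sum>x\<in>?X. \<Sum>y\<in>?X. ?\<pi> x * ?\<pi> y * (f x - f y)\<^sup>2)" by simp
  also have "\<dots> \<le> (\<Sum>x\<in>?X. \<Sum>y\<in>?X. \<nu> powr depth * (?n ^ 4 * (2 * ?Z * ?D)) / ?Z\<^sup>2)"
  proof (intro sum_mono)
    fix x y assume xy: "x \<in> ?X" "y \<in> ?X"
    have "?\<pi> x * ?\<pi> y * (f x - f y)\<^sup>2 = \<nu> ^ active N x * \<nu> ^ active N y * (f x - f y)\<^sup>2 / ?Z\<^sup>2"
      unfolding stationary_eq by (simp add: power2_eq_square)
    also have "\<dots> \<le> \<nu> powr depth * (?n ^ 4 * (2 * ?Z * ?D)) / ?Z\<^sup>2"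
      by (intro divide_right_mono pair_bound[OF \<nu> xy]) simp
    finally show "?\<pi> x * ?\<pi> y * (f x - f y)\<^sup>2 \<le> \<nu> powr depth * (?n ^ 4 * (2 * ?Z * ?D)) / ?Z\<^sup>2" .
  qed
  also have "\<dots> = 2 * (?n ^ 6 * \<nu> powr depth * ?D / ?Z)"
    using Z by (simp add: power2_eq_square eval_nat_numeral)
  finally have "V \<le> ?n ^ 6 * \<nu> powr depth * ?D / ?Z" by simp
  also have "\<dots> \<le> ?n ^ 6 * \<nu> powr depth * ?D / \<nu> ^ ?A"
    using partition_fun_ge[OF \<nu>] \<nu> D0 by (intro divide_left_mono) (auto intro!: mult_pos_pos Z)
  also have "\<dots> = ?n ^ 6 * \<nu> powr (depth - ?A) * ?D"
    using \<nu> by (simp add: powr_diff powr_realpow)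
  finally have "\<nu> powr (?A - depth) / ?n ^ 6 * V \<le> \<nu> powr (?A - depth) / ?n ^ 6 * (?n ^ 6 * \<nu> powr (depth - ?A) * ?D)"
    by (rule mult_left_mono) simp
  also have "\<dots> = (\<nu> powr (?A - depth) * \<nu> powr (depth - ?A)) * ?D"
    using card_states_pos by simp
  also have "\<dots> = ?D" using \<nu> by (simp flip: powr_add)
  finally show ?thesis unfolding V_def .
qed

section \<open>Upper bound and the limit\<close>

lemma mix_dist_small:
  assumes \<nu>: "1 < \<nu>" and "0 < \<epsilon>" "\<epsilon> < 1 / 2"
  defines "T \<equiv> real (card (states N C E)) ^ 6 / 2 * \<nu> powr (depth - max_active N C E) *
    ln (real (card (states N C E)) / \<epsilon>\<^sup>2 * \<nu> ^ max_active N C E)"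
  shows "0 \<le> T" "mix_dist N C E \<nu> T \<le> \<epsilon>"
proof -
  interpret chain: reversible_chain "states N C E" "stationary N C E \<nu>" "generator N C E \<nu>" "transition N C E \<nu>"
    by (rule reversible_chain_activity[OF \<nu>])
  let ?X = "states N C E" and ?n = "real (card (states N C E))" and ?\<pi> = "stationary N C E \<nu>"
  let ?A = "max_active N C E"
  \<comment> \<open>\<open>r\<close> is the Poincare constant, and \<open>T\<close> is chosen to
    make \<open>exp (- 2 * r * T)\<close> equal \<open>1 / W\<close>. As \<open>1 / ?\<pi> x\<close>
    is at most \<open>?n * \<nu> ^ ?A\<close>, the bound of \<open>tv_decay\<close> becomes
    \<open>\<epsilon>\<^sup>2\<close>.\<close>
  define r where "r = \<nu> powr (?A - depth) / ?n ^ 6"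
  define W where "W = ?n / \<epsilon>\<^sup>2 * \<nu> ^ ?A"
  \<comment> \<open>This leads to \<open>1 \<le> W\<close>, so the logarithm in \<open>T\<close> is
    nonnegative.\<close>
  have "\<epsilon>\<^sup>2 \<le> 1" using assms by (intro power_le_one) auto
  then have "1 \<le> ?n / \<epsilon>\<^sup>2" using card_states_pos \<open>0 < \<epsilon>\<close> by (simp add: field_simps)
  moreover have "1 \<le> \<nu> ^ ?A" using \<nu> by (intro one_le_power) simp
  ultimately have W: "1 \<le> W" unfolding W_def using mult_mono[of 1 "?n / \<epsilon>\<^sup>2" 1 "\<nu> ^ ?A"] by simp
  show T0: "0 \<le> T" unfolding T_def W_def[symmetric] using W by (intro mult_nonneg_nonneg) auto
  have "2 * r * T = (\<nu> powr (?A - depth) * \<nu> powr (depth - ?A)) * ln W"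
    unfolding r_def T_def W_def[symmetric] using card_states_pos by simp
  also have "\<dots> = ln W" using \<nu> by (simp flip: powr_add)
  finally have exp: "exp (- 2 * r * T) = 1 / W" using W by (simp add: exp_minus divide_inverse)
  have "tv_dist ?X (transition N C E \<nu> T x) ?\<pi> \<le> \<epsilon>" if x: "x \<in> ?X" for x
  proof -
    have "(tv_dist ?X (transition N C E \<nu> T x) ?\<pi>)\<^sup>2 \<le> exp (- 2 * r * T) / ?\<pi> x"
      by (rule chain.tv_decay[OF _ x T0]) (use poincare[OF \<nu>] in \<open>simp add: r_def\<close>)
    also have "\<dots> = (1 / W) * (1 / ?\<pi> x)" unfolding exp by simp
    also have "\<dots> \<le> (1 / W) * (?n * \<nu> ^ ?A)"
    proof (rule mult_left_mono)
      have "1 / ?\<pi> x = partition_fun \<nu> / \<nu> ^ active N x" unfolding stationary_eq by simp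
      also have "\<dots> \<le> partition_fun \<nu> / 1"
        using \<nu> partition_fun_pos[OF \<nu>] by (intro divide_left_mono one_le_power) auto
      finally show "1 / ?\<pi> x \<le> ?n * \<nu> ^ ?A" using partition_fun_le[OF \<nu>] by simp
      show "0 \<le> 1 / W" using W by simp
    qed
    also have "\<dots> = \<epsilon>\<^sup>2" unfolding W_def using \<nu> card_states_pos \<open>0 < \<epsilon>\<close> by simp
    finally show ?thesis using \<open>0 < \<epsilon>\<close> by (auto intro: power2_le_imp_le)
  qed
  then show "mix_dist N C E \<nu> T \<le> \<epsilon>" unfolding mix_dist_le_iff by blast
qed

lemma log_t_mix_tendsto:
  assumes "0 < \<epsilon>" "\<epsilon> < 1 / 2"
  shows "((\<lambda>\<nu>. log \<nu> (t_mix N C E \<epsilon> \<nu>)) \<longlongrightarrow> depth - max_active N C E) at_top"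
proof (rule log_tendsto_of_bounds)
  let ?n = "real (card (states N C E))"
  show "0 < (1 / 2 - \<epsilon>) / ?n ^ 3" "0 < ?n ^ 6 / 2" "0 < ?n / \<epsilon>\<^sup>2"
    using assms card_states_pos by simp_all
  fix \<nu> :: real assume \<nu>: "1 < \<nu>"
  note T = mix_dist_small[OF \<nu> assms]
  show "(1 / 2 - \<epsilon>) / ?n ^ 3 * \<nu> powr (depth - max_active N C E) \<le> t_mix N C E \<epsilon> \<nu>"
    unfolding t_mix_def using T mixing_time_ge[OF \<nu> assms(2)] by (intro cInf_greatest) blast+
  show "t_mix N C E \<epsilon> \<nu> \<le> ?n ^ 6 / 2 * \<nu> powr (depth - max_active N C E) * ln (?n / \<epsilon>\<^sup>2 * \<nu> ^ max_active N C E)"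
    unfolding t_mix_def using T by (intro cInf_lower bdd_belowI[of _ 0]) auto
qed

end

theorem theorem6p1:
  fixes N C :: nat
    and E :: "nat \<Rightarrow> (nat \<times> nat) set"
    and \<epsilon> :: real
  assumes "1 \<le> N" and "1 \<le> C"
    and "\<And>c. c \<in> {1..C} \<Longrightarrow> simple_graph_on {1..N} (E c)"
    and "0 < \<epsilon>" and "\<epsilon> < 1 / 2"
  shows "(2 \<le> card (dominant N C E) \<longrightarrow> 1 \<le> worst_height N C E) \<and>
    (\<exists>L::real. ((\<lambda>\<nu>. log \<nu> (t_mix N C E \<epsilon> \<nu>)) \<longlongrightarrow> L) at_top \<and>
      real (worst_height N C E) - 1 \<le> L)"
proof -
  interpret activity_process N C E by unfold_locales (fact assms)+
  \<comment> \<open>The limit \<open>L\<close> is \<open>depth - max_active N C E\<close>.\<close>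
  show ?thesis
    using worst_height_pos log_t_mix_tendsto[OF assms(4,5)] worst_height_le_depth by blast
qed

end
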